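(* Let $n=2m$ with $m>2$, and let $\mathfrak{g}$ be a real solvable non-nilpotent Lie algebra which is a one-dimensional extension of its nilradical $\mathfrak{n}=Q_n$. Put $$f(t)=\frac{(n-3)n-(t-3)(t-2)}{2(n-t+2)},\qquad p=\left[\,n+2-\sqrt{2n}\,\right],$$ where $[\cdot]$ denotes the integer part, and let $l\in\{p,p+1\}$ be such that $f(l)=\max(f(p),f(p+1))$. Then $\mathfrak{g}$ admits an inner product of negative Ricci curvature if and only if $\mathfrak{g}$ is the extension of $\mathfrak{n}$ by a vector $Y$ (that is, $\mathfrak{g}=\mathbb{R}Y\oplus\mathfrak{n}$) such that $\iota_n(Y)>0$ and $\iota_l(Y)>0$.
   Context: All Lie algebras are real and finite-dimensional. The nilradical of a Lie algebra is its maximal nilpotent ideal; a solvable Lie algebra $\mathfrak{g}$ with nilradical $\mathfrak{n}$ is a one-dimensional extension of $\mathfrak{n}$ if $\dim\mathfrak{g}=\dim\mathfrak{n}+1$. The algebra $Q_n=\operatorname{Span}(X_1,\dots,X_n)$, $n=2m$, is defined by $[X_1,X_i]=X_{i+1}$, $i=2,\dots,n-2$, and $[X_j,X_{n-j+1}]=(-1)^{j+1}X_n$, $j=2,\dots,n-1$; brackets of basis elements that are not listed and do not follow from the listed ones by skew-symmetry are zero. The subspaces $\mathfrak{i}_k=\operatorname{Span}(X_k,\dots,X_n)$, $k=3,\dots,n$, are members of the lower central series of $Q_n$, so are invariant under every derivation. For a solvable extension $\mathfrak{g}$ of $Q_n$, the one-forms $\iota_k$, $k=3,\dots,n$, on $\mathfrak{g}$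 are defined by $\iota_k(Y)=\operatorname{Tr}((\operatorname{ad}_Y)_{|\mathfrak{i}_k})$ for $Y\in\mathfrak{g}$. Ricci curvature: for an inner product $\langle\cdot,\cdot\rangle$ on $\mathfrak{g}$, let $B$ be the Killing form of $\mathfrak{g}$, let $H\in\mathfrak{g}$ be defined by $\langle H,X\rangle=\operatorname{Tr}\operatorname{ad}_X$ for all $X\in\mathfrak g$, and let $\{E_i\}$ be an orthonormal basis. The Ricci curvature is the quadratic form $$\mathrm{ric}(X)=-\langle[H,X],X\rangle-\tfrac12B(X,X)-\tfrac12\sum_i\|[X,E_i]\|^2+\tfrac14\sum_{i,j}\langle[E_i,E_j],X\rangle^2 .$$ The inner product has negative Ricci curvature if $\mathrm{ric}(X)<0$ for all nonzero $X\in\mathfrak{g}$. *)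

theory Defs
  imports "HOL-Analysis.Analysis"
begin

text \<open>
  A finite-dimensional real Lie algebra is given by a bracket on a finite-dimensional
  real vector space, represented by a type of class \<open>real_vector\<close>. No norm, topology or
  distinguished inner product is part of the structure.
\<close>

definition lie_algebra :: "('a::real_vector \<Rightarrow> 'a \<Rightarrow> 'a) \<Rightarrow> bool" where
  "lie_algebra br \<longleftrightarrow>
     (\<exists>B::'a set. finite B \<and> span B = UNIV) \<and>
     bilinear br \<and>
     (\<forall>x. br x x = 0) \<and>
     (\<forall>x y z. br x (br y z) + br y (br z x) + br z (br x y) = 0)"

definition lie_ideal :: "('a::real_vector \<Rightarrow> 'a \<Rightarrow> 'a) \<Rightarrow> 'a set \<Rightarrow> bool" where
  "lie_ideal br I \<longleftrightarrow> subspace I \<and> (\<forall>x. \<forall>y\<in>I. br x y \<in> I)"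

definition bracket_span ::
  "('a::real_vector \<Rightarrow> 'a \<Rightarrow> 'a) \<Rightarrow> 'a set \<Rightarrow> 'a set \<Rightarrow> 'a set" where
  "bracket_span br A B = span {br a b | a b. a \<in> A \<and> b \<in> B}"

primrec lower_central :: "('a::real_vector \<Rightarrow> 'a \<Rightarrow> 'a) \<Rightarrow> 'a set \<Rightarrow> nat \<Rightarrow> 'a set" where
  "lower_central br A 0 = A"
| "lower_central br A (Suc k) = bracket_span br A (lower_central br A k)"

primrec derived_series :: "('a::real_vector \<Rightarrow> 'a \<Rightarrow> 'a) \<Rightarrow> 'a set \<Rightarrow> nat \<Rightarrow> 'a set" where
  "derived_series br A 0 = A"
| "derived_series br A (Suc k) =
     bracket_span br (derived_series br A k) (derived_series br A k)"

definition lie_nilpotent :: "('a::real_vector \<Rightarrow> 'a \<Rightarrow> 'a) \<Rightarrow> 'a set \<Rightarrow> bool" where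
  "lie_nilpotent br A \<longleftrightarrow> (\<exists>k. lower_central br A k = {0})"

definition lie_solvable :: "('a::real_vector \<Rightarrow> 'a \<Rightarrow> 'a) \<Rightarrow> 'a set \<Rightarrow> bool" where
  "lie_solvable br A \<longleftrightarrow> (\<exists>k. derived_series br A k = {0})"

text \<open>
  Maximality is with respect to inclusion; as a sum of nilpotent ideals is nilpotent,
  a maximal nilpotent ideal is the largest one.
\<close>

definition is_nilradical :: "('a::real_vector \<Rightarrow> 'a \<Rightarrow> 'a) \<Rightarrow> 'a set \<Rightarrow> bool" where
  "is_nilradical br N \<longleftrightarrow>
     lie_ideal br N \<and> lie_nilpotent br N \<and>
     (\<forall>J. lie_ideal br J \<and> lie_nilpotent br J \<and> N \<subseteq> J \<longrightarrow> J = N)"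

definition one_dim_extension :: "('a::real_vector \<Rightarrow> 'a \<Rightarrow> 'a) \<Rightarrow> 'a set \<Rightarrow> bool" where
  "one_dim_extension br N \<longleftrightarrow>
     lie_solvable br (UNIV :: 'a set) \<and> is_nilradical br N \<and>
     dim (UNIV :: 'a set) = dim N + 1"

text \<open>
  \<open>Q_listed n i j\<close>: the bracket of the i-th and j-th basis vectors is one of the listed
  brackets. The two families of listed brackets are disjoint, and the second one is
  symmetric in i and j.
\<close>

definition Q_listed :: "nat \<Rightarrow> nat \<Rightarrow> nat \<Rightarrow> bool" where
  "Q_listed n i j \<longleftrightarrow>
     (i = 1 \<and> 2 \<le> j \<and> j \<le> n - 2) \<or>
     (2 \<le> i \<and> i \<le> n - 1 \<and> j = n - i + 1)"

definition is_Q ::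
  "('a::real_vector \<Rightarrow> 'a \<Rightarrow> 'a) \<Rightarrow> nat \<Rightarrow> (nat \<Rightarrow> 'a) \<Rightarrow> 'a set \<Rightarrow> bool" where
  "is_Q br n X N \<longleftrightarrow>
     inj_on X {1..n} \<and> independent (X ` {1..n}) \<and> span (X ` {1..n}) = N \<and>
     (\<forall>i\<in>{2..n-2}. br (X 1) (X i) = X (i + 1)) \<and>
     (\<forall>j\<in>{2..n-1}. br (X j) (X (n - j + 1)) = (-1) ^ (j + 1) *\<^sub>R X n) \<and>
     (\<forall>i\<in>{1..n}. \<forall>j\<in>{1..n}. \<not> Q_listed n i j \<and> \<not> Q_listed n j i \<longrightarrow> br (X i) (X j) = 0)"

text \<open>
  Trace of the restriction of \<open>f\<close> to an \<open>f\<close>-invariant finite-dimensional subspace \<open>S\<close>: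
  the sum of the diagonal matrix entries with respect to some basis of \<open>S\<close>.
\<close>

definition trace_on :: "'a::real_vector set \<Rightarrow> ('a \<Rightarrow> 'a) \<Rightarrow> real" where
  "trace_on S f =
     (let B = (SOME B. independent B \<and> span B = S)
      in \<Sum>b\<in>B. representation B (f b) b)"

definition iota ::
  "('a::real_vector \<Rightarrow> 'a \<Rightarrow> 'a) \<Rightarrow> nat \<Rightarrow> (nat \<Rightarrow> 'a) \<Rightarrow> nat \<Rightarrow> 'a \<Rightarrow> real" where
  "iota br n X k Y = trace_on (span (X ` {k..n})) (br Y)"

definition is_inner_product :: "('a::real_vector \<Rightarrow> 'a \<Rightarrow> real) \<Rightarrow> bool" where
  "is_inner_product ip \<longleftrightarrow>
     bilinear ip \<and> (\<forall>x y. ip x y = ip y x) \<and> (\<forall>x. x \<noteq> 0 \<longrightarrow> ip x x > 0)"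

definition is_orthonormal_basis :: "('a::real_vector \<Rightarrow> 'a \<Rightarrow> real) \<Rightarrow> 'a set \<Rightarrow> bool" where
  "is_orthonormal_basis ip E \<longleftrightarrow>
     independent E \<and> span E = UNIV \<and>
     (\<forall>x\<in>E. \<forall>y\<in>E. ip x y = (if x = y then 1 else 0))"

definition killing_form :: "('a::real_vector \<Rightarrow> 'a \<Rightarrow> 'a) \<Rightarrow> 'a \<Rightarrow> 'a \<Rightarrow> real" where
  "killing_form br x y = trace_on UNIV (\<lambda>z. br x (br y z))"

definition mean_curvature_vector ::
  "('a::real_vector \<Rightarrow> 'a \<Rightarrow> 'a) \<Rightarrow> ('a \<Rightarrow> 'a \<Rightarrow> real) \<Rightarrow> 'a" where
  "mean_curvature_vector br ip = (THE h. \<forall>x. ip h x = trace_on UNIV (br x))"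

text \<open>The value does not depend on the orthonormal basis that is chosen.\<close>

definition ric ::
  "('a::real_vector \<Rightarrow> 'a \<Rightarrow> 'a) \<Rightarrow> ('a \<Rightarrow> 'a \<Rightarrow> real) \<Rightarrow> 'a \<Rightarrow> real" where
  "ric br ip x =
     (let E = (SOME E. is_orthonormal_basis ip E); h = mean_curvature_vector br ip
      in - ip (br h x) x - 1/2 * killing_form br x x
         - 1/2 * (\<Sum>e\<in>E. ip (br x e) (br x e))
         + 1/4 * (\<Sum>e\<in>E. \<Sum>e'\<in>E. (ip (br e e') x)\<^sup>2))"

definition negative_ricci ::
  "('a::real_vector \<Rightarrow> 'a \<Rightarrow> 'a) \<Rightarrow> ('a \<Rightarrow> 'a \<Rightarrow> real) \<Rightarrow> bool" where
  "negative_ricci br ip \<longleftrightarrow> (\<forall>x. x \<noteq> 0 \<longrightarrow> ric br ip x < 0)"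

definition is_direct_sum :: "'a::real_vector set \<Rightarrow> 'a set \<Rightarrow> 'a set \<Rightarrow> bool" where
  "is_direct_sum V U W \<longleftrightarrow> U \<inter> W = {0} \<and> V = {u + w | u w. u \<in> U \<and> w \<in> W}"

definition Q_ratio :: "nat \<Rightarrow> real \<Rightarrow> real" where
  "Q_ratio n t =
     ((real n - 3) * real n - (t - 3) * (t - 2)) / (2 * (real n - t + 2))"

end

theory Submission
  imports Defs
begin

text \<open>
  Fix a vector \<open>Y\<close> outside the nilradical \<open>N = Q_n\<close>. In the basis \<open>X_1, ..., X_n\<close> the derivation
  \<open>ad Y\<close> of \<open>N\<close> is triangular, and its diagonal is determined by two numbers \<open>a\<close>, \<open>b\<close>: the entries
  are \<open>a\<close>, \<open>b + (i - 2) a\<close> for \<open>2 \<le> i < n\<close>, and \<open>2 b + (n - 3) a\<close> (\<open>Q_adjoint_matrix\<close>). Summing,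
  \<open>\<iota>_k(Y)\<close> is a positive multiple of \<open>b + f(k) a\<close>. On the integers \<open>2, ..., n\<close> the function \<open>f\<close> is
  smallest at \<open>n\<close> and largest at \<open>l\<close>, so positivity of \<open>\<iota>_n\<close> and \<open>\<iota>_l\<close> is the same as
  positivity of all \<open>\<iota>_k\<close> (\<open>Q_weight_positivity\<close>).

  Necessity. If \<open>A\<close> is an abelian ideal, the sum of the Ricci curvature over an orthonormal basis
  of \<open>A\<close> is \<open>- Tr (ad H | A)\<close> plus a nonnegative term, where \<open>H\<close> is the mean curvature vector
  (\<open>abelian_ideal_trace_pos\<close>). Negative Ricci curvature thus forces \<open>Tr (ad H | A) > 0\<close>. The
  span of \<open>X_k, ..., X_n\<close> is an abelian ideal as soon as \<open>2 k > n + 1\<close>, and both \<open>l\<close> and \<open>n\<close>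
  are in this range, so \<open>Y = H\<close> works; \<open>H\<close> lies outside \<open>N\<close> because \<open>X_n\<close> is central in \<open>N\<close>.

  Sufficiency. Take \<open>Y\<close> and suitable multiples of \<open>X_1, ..., X_n\<close> as an orthonormal basis. The
  algebra \<open>N\<close> has the grading automorphisms that multiply \<open>X_i\<close> by \<open>t^i\<close> for \<open>i < n\<close> and \<open>X_n\<close>
  by \<open>t^(n + 1)\<close>. Rescaling the basis by them does not change the metric on \<open>N\<close> up to isometry, but it
  sends the off-diagonal part of \<open>ad Y\<close> to \<open>0\<close>. In the limit the Ricci form is diagonal
  (\<open>ricci_coeff_diagonal_extension\<close>): its entry at \<open>Y\<close> is \<open>- \<Sum> d_i^2\<close>, and its entry at \<open>X_i\<close> is
  the Ricci curvature of \<open>N\<close> minus \<open>(Tr ad Y) d_i\<close>, with \<open>d_i\<close> the diagonal of \<open>ad Y\<close>. It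
  remains to find a diagonal metric on \<open>N\<close> whose Ricci curvature lies below \<open>(Tr ad Y) d\<close>.

  For such a metric the Ricci curvature of \<open>N\<close> is a combination of the vectors
  \<open>e_k - e_i - e_j\<close>, one for each bracket \<open>[X_i, X_j] = \<plusminus> X_k\<close>, with positive coefficients that are
  monomials in the squared lengths. These monomials satisfy relations, so they cannot be prescribed
  freely. Their combination can: it is the gradient of a convex function, and by a coercivity
  argument it takes, up to any error, each value \<open>\<Sum> c_w (e_k - e_i - e_j)\<close> with \<open>c_w > 0\<close>
  (\<open>approximate_monomial_moments\<close>). Coefficients \<open>c_w\<close> for which this value is below \<open>d\<close> are
  written down in terms of the numbers \<open>\<iota>_k\<close>, whose positivity makes the choice admissible
  (\<open>Q_weight_dominates\<close>).
\<close>

section \<open>Traces and bases\<close>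

lemma representation_family:
  fixes e :: "'i \<Rightarrow> 'a::real_vector"
  assumes "finite I" "inj_on e I" "independent (e ` I)" "i \<in> I"
  shows "representation (e ` I) (\<Sum>j\<in>I. a j *\<^sub>R e j) (e i) = a i"
proof -
  have "representation (e ` I) (\<Sum>j\<in>I. a j *\<^sub>R e j) (e i)
      = (\<Sum>j\<in>I. representation (e ` I) (a j *\<^sub>R e j) (e i))"
    using assms by (subst representation_sum) (auto intro: span_scale span_base)
  also have "\<dots> = (\<Sum>j\<in>I. if j = i then a j else 0)"
  proof (rule sum.cong[OF refl])
    fix j assume j: "j \<in> I"
    have "representation (e ` I) (a j *\<^sub>R e j) (e i)
        = a j * representation (e ` I) (e j) (e i)"
      using assms j by (simp add: representation_scale span_base)
    also have "representation (e ` I) (e j) (e i) = (if e i = e j then 1 else 0)"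
      using assms j by (simp add: representation_basis)
    finally show "representation (e ` I) (a j *\<^sub>R e j) (e i) = (if j = i then a j else 0)"
      using assms j by (auto simp: inj_on_def)
  qed
  finally show ?thesis using assms by simp
qed

lemma coefficients_unique:
  fixes e :: "'i \<Rightarrow> 'a::real_vector"
  assumes "finite I" "inj_on e I" "independent (e ` I)" "i \<in> I"
    and "(\<Sum>j\<in>I. a j *\<^sub>R e j) = (\<Sum>j\<in>I. b j *\<^sub>R e j)"
  shows "a i = b i"
  using representation_family[OF assms(1-4), of a] representation_family[OF assms(1-4), of b]
    assms(5) by simp

lemma in_span_family:
  fixes e :: "'i \<Rightarrow> 'a::real_vector"
  assumes "finite I" "inj_on e I" "v \<in> span (e ` I)"
  obtains a where "v = (\<Sum>j\<in>I. a j *\<^sub>R e j)"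
proof -
  obtain u where "v = (\<Sum>w\<in>e ` I. u w *\<^sub>R w)"
    using assms(3) span_finite[of "e ` I"] assms(1) by auto
  then have "v = (\<Sum>j\<in>I. u (e j) *\<^sub>R e j)"
    using assms(2) by (simp add: sum.reindex)
  then show ?thesis by (rule that)
qed

text \<open>
  Expanding the vectors of either basis in the other one turns both sums into the same double sum.
  The invariance of \<open>S\<close> is essential: it keeps the coordinates of \<open>f b\<close> meaningful.
\<close>

lemma diagonal_sum_basis_independent:
  fixes f :: "'a::real_vector \<Rightarrow> 'a"
  assumes B: "finite B" "independent B" "span B = S"
    and C: "finite C" "independent C" "span C = S"
    and f: "linear f" "\<And>x. x \<in> S \<Longrightarrow> f x \<in> S"
  shows "(\<Sum>b\<in>B. representation B (f b) b) = (\<Sum>c\<in>C. representation C (f c) c)"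
proof -
  have mem: "b \<in> span C" if "b \<in> B" for b using that B(3) C(3) span_base by blast
  have memC: "b \<in> S" if "b \<in> C" for b using that C span_base by blast
  have "(\<Sum>b\<in>B. representation B (f b) b)
      = (\<Sum>b\<in>B. \<Sum>c\<in>C. representation C b c * representation B (f c) b)"
  proof (rule sum.cong[OF refl])
    fix b assume b: "b \<in> B"
    have "f b = f (\<Sum>c\<in>C. representation C b c *\<^sub>R c)"
      using C(1,2) mem[OF b] by (simp add: sum_representation_eq)
    also have "\<dots> = (\<Sum>c\<in>C. representation C b c *\<^sub>R f c)"
      using f(1) by (simp add: linear_sum linear_scale)
    finally have "f b = (\<Sum>c\<in>C. representation C b c *\<^sub>R f c)" .
    moreover have "representation C b c *\<^sub>R f c \<in> span B" if "c \<in> C" for c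
      using f(2)[OF memC[OF that]] B(3) span_scale by blast
    ultimately have "representation B (f b) b
        = (\<Sum>c\<in>C. representation B (representation C b c *\<^sub>R f c) b)"
      by (simp add: representation_sum[OF B(2)])
    also have "\<dots> = (\<Sum>c\<in>C. representation C b c * representation B (f c) b)"
      using B f memC by (simp add: representation_scale)
    finally show "representation B (f b) b
        = (\<Sum>c\<in>C. representation C b c * representation B (f c) b)" .
  qed
  also have "\<dots> = (\<Sum>c\<in>C. \<Sum>b\<in>B. representation C b c * representation B (f c) b)"
    by (rule sum.swap)
  also have "\<dots> = (\<Sum>c\<in>C. representation C (f c) c)"
  proof (rule sum.cong[OF refl])
    fix c assume c: "c \<in> C"
    have "f c = (\<Sum>b\<in>B. representation B (f c) b *\<^sub>R b)"
      using B f memC[OF c] by (simp add: sum_representation_eq)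
    then have "representation C (f c) c
        = representation C (\<Sum>b\<in>B. representation B (f c) b *\<^sub>R b) c" by simp
    also have "\<dots> = (\<Sum>b\<in>B. representation B (f c) b * representation C b c)"
      using C(1,2) mem by (simp add: representation_sum[OF C(2)] span_scale representation_scale[OF C(2)])
    finally show "(\<Sum>b\<in>B. representation C b c * representation B (f c) b)
        = representation C (f c) c" by (simp add: mult.commute)
  qed
  finally show ?thesis .
qed

lemma trace_on_basis:
  fixes f :: "'a::real_vector \<Rightarrow> 'a"
  assumes "finite B" "independent B" "span B = S" "linear f" "\<And>x. x \<in> S \<Longrightarrow> f x \<in> S"
  shows "trace_on S f = (\<Sum>b\<in>B. representation B (f b) b)"
proof -
  define C where "C = (SOME B. independent B \<and> span B = S)"
  have C: "independent C \<and> span C = S"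
    unfolding C_def using assms by (intro someI[of "\<lambda>B. independent B \<and> span B = S"]) auto
  then have "finite C"
    using independent_span_bound[OF assms(1), of C] assms(3) span_superset by blast
  then show ?thesis
    unfolding trace_on_def Let_def C_def[symmetric]
    using C assms by (intro diagonal_sum_basis_independent) auto
qed

text \<open>
  The form in which all traces below are computed: a matrix with respect to an indexed basis,
  independently of the basis that the definition of the trace picks.
\<close>

lemma trace_on_family:
  fixes f :: "'a::real_vector \<Rightarrow> 'a"
  assumes e: "finite I" "inj_on e I" "independent (e ` I)"
    and f: "linear f" "\<And>i. i \<in> I \<Longrightarrow> f (e i) = (\<Sum>j\<in>I. M i j *\<^sub>R e j)"
  shows "trace_on (span (e ` I)) f = (\<Sum>i\<in>I. M i i)"
proof -
  have inv: "f x \<in> span (e ` I)" if x: "x \<in> span (e ` I)" for x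
  proof -
    obtain a where "x = (\<Sum>j\<in>I. a j *\<^sub>R e j)" using in_span_family[OF e(1,2) x] by blast
    then have "f x = (\<Sum>j\<in>I. a j *\<^sub>R f (e j))" using f(1) by (simp add: linear_sum linear_scale)
    moreover have "f (e j) \<in> span (e ` I)" if "j \<in> I" for j
      unfolding f(2)[OF that] by (intro span_sum span_scale span_base imageI)
    ultimately show ?thesis by (auto intro: span_sum span_scale)
  qed
  have "trace_on (span (e ` I)) f = (\<Sum>b\<in>e ` I. representation (e ` I) (f b) b)"
    using e f inv by (intro trace_on_basis) auto
  also have "\<dots> = (\<Sum>i\<in>I. representation (e ` I) (f (e i)) (e i))"
    using e by (simp add: sum.reindex)
  also have "\<dots> = (\<Sum>i\<in>I. M i i)"
    using e f by (intro sum.cong) (auto simp: representation_family)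
  finally show ?thesis .
qed

text \<open>
  A basis of \<open>N\<close> together with \<open>Y\<close> is independent and has as many elements as the dimension of
  the space, so it cannot be enlarged.
\<close>

lemma direct_sum_line:
  fixes N :: "'a::real_vector set"
  assumes fin: "finite C" "span C = (UNIV :: 'a set)"
    and B: "finite B" "independent B" "span B = N"
    and dim: "dim (UNIV :: 'a set) = dim N + 1" and Y: "Y \<notin> N"
  shows "is_direct_sum UNIV (span {Y}) N"
proof -
  have ind: "independent (insert Y B)" using B Y by (simp add: independent_insertI)
  obtain D where D: "insert Y B \<subseteq> D" "independent D" "UNIV \<subseteq> span D"
    by (rule maximal_independent_subset_extend[OF subset_UNIV ind]) (rule that)
  have finD: "finite D" using independent_span_bound[OF fin(1) D(2)] fin(2) by simp
  have "card D = dim (UNIV :: 'a set)" using D by (intro dim_eq_card[symmetric]) auto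
  also have "\<dots> = card B + 1" using dim B dim_span_eq_card_independent[of B] by simp
  also have "\<dots> = card (insert Y B)" using B Y span_base[of Y B] by (subst card_insert_disjoint) auto
  finally have "insert Y B = D" using D(1) finD by (intro card_subset_eq) auto
  then have UN: "span (insert Y B) = UNIV" using D(3) by auto
  show ?thesis
    unfolding is_direct_sum_def
  proof (intro conjI subset_antisym subsetI)
    fix x assume x: "x \<in> span {Y} \<inter> N"
    then obtain t where t: "x = t *\<^sub>R Y" by (auto simp: span_singleton)
    show "x \<in> {0}"
    proof (cases "t = 0")
      case False
      have "(1 / t) *\<^sub>R x \<in> N" using x B(3) span_scale by blast
      then show ?thesis using Y t False by simp
    qed (simp add: t)
  next
    fix x :: 'a assume "x \<in> {0}"
    then show "x \<in> span {Y} \<inter> N" using B(3) span_0 by auto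
  next
    fix x :: 'a
    have "x \<in> span (insert Y B)" using UN by simp
    then obtain t where "x - t *\<^sub>R Y \<in> N" using B(3) by (auto simp: span_insert)
    moreover have "t *\<^sub>R Y \<in> span {Y}" by (simp add: span_scale span_base)
    ultimately show "x \<in> {u + w |u w. u \<in> span {Y} \<and> w \<in> N}"
      by (intro CollectI exI[of _ "t *\<^sub>R Y"] exI[of _ "x - t *\<^sub>R Y"]) simp
  qed simp
qed

text \<open>
  The inner product is the sum of products of coordinates, divided by the squared scaling factors;
  this gives a metric for which prescribed multiples of a basis are orthonormal.
\<close>

lemma frame_inner_product:
  fixes e :: "'i \<Rightarrow> 'a::real_vector"
  assumes I: "finite I" and inj: "inj_on e I" and ind: "independent (e ` I)" and sp: "span (e ` I) = UNIV"
    and r: "\<And>i. i \<in> I \<Longrightarrow> r i \<noteq> 0"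
  obtains ip where "is_inner_product ip"
    and "\<And>i j. i \<in> I \<Longrightarrow> j \<in> I \<Longrightarrow> ip (r i *\<^sub>R e i) (r j *\<^sub>R e j) = (if i = j then 1 else 0)"
proof -
  define c where "c v i = representation (e ` I) v (e i) / r i" for v i
  define ip where "ip v w = (\<Sum>i\<in>I. c v i * c w i)" for v w
  have c_add: "c (v + w) i = c v i + c w i" and c_scale: "c (t *\<^sub>R v) i = t * c v i" for v w t i
    using ind sp by (simp_all add: c_def representation_add representation_scale add_divide_distrib)
  have "ip v v > 0" if "v \<noteq> 0" for v
  proof -
    obtain a where a: "v = (\<Sum>j\<in>I. a j *\<^sub>R e j)" using in_span_family[OF I inj, of v] sp by auto
    have "\<exists>i\<in>I. a i \<noteq> 0"
    proof (rule ccontr)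
      assume "\<not> (\<exists>i\<in>I. a i \<noteq> 0)"
      then have "v = 0" unfolding a by (intro sum.neutral) auto
      then show False using that by simp
    qed
    then obtain i where i: "i \<in> I" "a i \<noteq> 0" by blast
    then have "c v i \<noteq> 0" using representation_family[OF I inj ind i(1), of a] r a by (simp add: c_def)
    then show ?thesis
      unfolding ip_def using i I by (intro sum_pos2[of I i]) (auto simp: zero_less_mult_iff neq_iff)
  qed
  then have "is_inner_product ip"
    unfolding is_inner_product_def bilinear_def ip_def
    by (auto simp: c_add c_scale algebra_simps sum.distrib sum_distrib_left intro!: linearI)
  moreover have "ip (r i *\<^sub>R e i) (r j *\<^sub>R e j) = (if i = j then 1 else 0)" if ij: "i \<in> I" "j \<in> I" for i j
  proof -
    have ce: "c (r i *\<^sub>R e i) k = (if k = i then 1 else 0)" if ik: "i \<in> I" "k \<in> I" for i k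
    proof -
      have "representation (e ` I) (e i) (e k) = (if k = i then 1 else 0)"
        using ik ind inj by (auto simp: representation_basis inj_on_def)
      then show ?thesis unfolding c_scale unfolding c_def using r ik by simp
    qed
    have "ip (r i *\<^sub>R e i) (r j *\<^sub>R e j) = (\<Sum>k\<in>I. if k = i then (if i = j then 1 else 0) else 0)"
      unfolding ip_def using ce ij by (intro sum.cong) auto
    then show ?thesis using I ij by simp
  qed
  ultimately show ?thesis by (rule that)
qed

section \<open>Inner products and orthonormal bases\<close>

locale inner_product_form =
  fixes ip :: "'a::real_vector \<Rightarrow> 'a \<Rightarrow> real"
  assumes ip: "is_inner_product ip"
    and finite_dim: "\<exists>B::'a set. finite B \<and> span B = UNIV"
begin

definition orthonormal :: "'a set \<Rightarrow> bool" where
  "orthonormal E \<longleftrightarrow> finite E \<and> (\<forall>x\<in>E. \<forall>y\<in>E. ip x y = (if x = y then 1 else 0))"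

lemma ip_bilinear: "bilinear ip" using ip by (simp add: is_inner_product_def)
lemma ip_sym: "ip x y = ip y x" using ip by (simp add: is_inner_product_def)
lemma ip_pos: "x \<noteq> 0 \<Longrightarrow> ip x x > 0" using ip by (simp add: is_inner_product_def)
lemma ip_linear: "linear (ip x)" "linear (\<lambda>x. ip x y)"
  using ip_bilinear by (auto simp: bilinear_def)

lemmas ip_simps = linear_add[OF ip_linear(1)] linear_add[OF ip_linear(2)]
  linear_diff[OF ip_linear(1)] linear_diff[OF ip_linear(2)]
  linear_scale[OF ip_linear(1)] linear_scale[OF ip_linear(2)]
  linear_sum[OF ip_linear(1)] linear_sum[OF ip_linear(2)]
  linear_0[OF ip_linear(1)] linear_0[OF ip_linear(2)]

lemma orthonormal_coefficient:
  assumes "orthonormal E" "x \<in> E"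
  shows "ip (\<Sum>e\<in>E. a e *\<^sub>R e) x = a x"
proof -
  have "ip (\<Sum>e\<in>E. a e *\<^sub>R e) x = (\<Sum>e\<in>E. if e = x then a e else 0)"
    unfolding ip_simps using assms by (intro sum.cong) (auto simp: orthonormal_def)
  then show ?thesis using assms by (simp add: orthonormal_def)
qed

lemma orthonormal_expansion:
  assumes "orthonormal E" "v \<in> span E"
  shows "(\<Sum>e\<in>E. ip v e *\<^sub>R e) = v"
proof -
  obtain a where a: "v = (\<Sum>w\<in>E. a w *\<^sub>R w)"
    using assms span_finite[of E] by (auto simp: orthonormal_def)
  show ?thesis
    using orthonormal_coefficient[OF assms(1), of _ a] unfolding a by (auto intro!: sum.cong)
qed

lemma orthonormal_independent:
  assumes "orthonormal E"
  shows "independent E"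
  unfolding independent_explicit_module
proof (intro allI impI)
  fix t u v
  assume t: "finite t" "t \<subseteq> E" "(\<Sum>v\<in>t. u v *\<^sub>R v) = 0" "v \<in> t"
  have "orthonormal t" using t assms unfolding orthonormal_def by (meson subsetD)
  then show "u v = 0" using orthonormal_coefficient[of t v u] t by (simp add: ip_simps)
qed

lemma parseval:
  assumes "orthonormal E" "v \<in> span E"
  shows "ip v w = (\<Sum>e\<in>E. ip v e * ip w e)"
proof -
  have "ip v w = ip (\<Sum>e\<in>E. ip v e *\<^sub>R e) w" using orthonormal_expansion[OF assms] by simp
  also have "\<dots> = (\<Sum>e\<in>E. ip v e * ip w e)" by (simp add: ip_simps ip_sym[of w])
  finally show ?thesis .
qed

text \<open>Gram-Schmidt: the orthonormal set is enlarged one spanning vector at a time.\<close>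

lemma orthonormal_extend:
  assumes "orthonormal F" "finite B"
  obtains E where "orthonormal E" "F \<subseteq> E" "span E = span (F \<union> B)"
  using assms(2)
proof (induction B arbitrary: thesis rule: finite_induct)
  case empty
  then show ?case using assms(1) by auto
next
  case (insert b B)
  obtain E where E: "orthonormal E" "F \<subseteq> E" "span E = span (F \<union> B)"
    using insert.IH by blast
  define p where "p = (\<Sum>e\<in>E. ip b e *\<^sub>R e)"
  define d where "d = b - p"
  have fin: "finite E" using E(1) by (simp add: orthonormal_def)
  have p: "p \<in> span E" unfolding p_def by (intro span_sum span_scale span_base)
  have d: "ip d e = 0" "ip e d = 0" if "e \<in> E" for e
    using orthonormal_coefficient[OF E(1) that, of "ip b"] ip_sym[of e d]
    by (auto simp: d_def p_def ip_simps)
  have sp: "span (F \<union> insert b B) = span (insert b E)"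
  proof -
    have "span (F \<union> insert b B) = span (insert b (F \<union> B))" by simp
    also have "\<dots> = span (insert b E)" unfolding span_insert E(3) ..
    finally show ?thesis .
  qed
  show ?case
  proof (cases "d = 0")
    case True
    then have "b \<in> span E" using p by (simp add: d_def)
    then show ?thesis using insert.prems E sp by (simp add: span_redundant)
  next
    case False
    define g where "g = (1 / sqrt (ip d d)) *\<^sub>R d"
    have pos: "ip d d > 0" using ip_pos False by blast
    have gg: "ip g g = 1" using pos by (simp add: g_def ip_simps field_simps)
    have ge: "ip g e = 0" "ip e g = 0" if "e \<in> E" for e using d[OF that] by (simp_all add: g_def ip_simps)
    have "orthonormal (insert g E)"
      using E(1) gg ge by (auto simp: orthonormal_def)
    moreover have "span (insert g E) = span (insert b E)"
    proof (rule subset_antisym)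
      have "b = p + sqrt (ip d d) *\<^sub>R g" using pos by (simp add: g_def d_def)
      moreover have "p \<in> span (insert g E)" using p span_mono[of E "insert g E"] by blast
      moreover have "g \<in> span (insert g E)" by (simp add: span_base)
      ultimately have "b \<in> span (insert g E)" using span_add span_scale by metis
      then show "span (insert b E) \<subseteq> span (insert g E)"
        by (intro span_minimal) (auto intro: span_base)
      have "p \<in> span (insert b E)" using p span_mono[of E "insert b E"] by blast
      then have "g \<in> span (insert b E)"
        unfolding g_def d_def by (intro span_scale span_diff) (auto intro: span_base)
      then show "span (insert g E) \<subseteq> span (insert b E)"
        by (intro span_minimal) (auto intro: span_base)
    qed
    ultimately show ?thesis using insert.prems E(2) sp by blast
  qed
qed

lemma orthonormal_basis_iff:
  "is_orthonormal_basis ip E \<longleftrightarrow> orthonormal E \<and> span E = UNIV"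
proof
  assume E: "is_orthonormal_basis ip E"
  obtain B :: "'a set" where "finite B" "span B = UNIV" using finite_dim by blast
  then have "finite E" using independent_span_bound[of B E] E by (auto simp: is_orthonormal_basis_def)
  then show "orthonormal E \<and> span E = UNIV" using E by (auto simp: orthonormal_def is_orthonormal_basis_def)
qed (auto simp: is_orthonormal_basis_def orthonormal_independent, auto simp: orthonormal_def)

lemma orthonormal_basis_extend:
  assumes "orthonormal F"
  obtains E where "orthonormal E" "span E = UNIV" "F \<subseteq> E"
proof -
  obtain B :: "'a set" where B: "finite B" "span B = UNIV" using finite_dim by blast
  obtain E where E: "orthonormal E" "F \<subseteq> E" "span E = span (F \<union> B)"
    using orthonormal_extend[OF assms B(1)] by blast
  have "span E = UNIV" using span_mono[of B "F \<union> B"] B(2) E(3) by auto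
  then show ?thesis using that E by blast
qed

text \<open>
  The trace of a bilinear form with respect to the inner product. Through this lemma the Ricci form
  does not depend on the orthonormal basis in its definition.
\<close>

lemma bilinear_trace_independent:
  assumes E: "orthonormal E" "span E = UNIV" and F: "orthonormal F" "span F = UNIV"
    and b: "bilinear (b :: 'a \<Rightarrow> 'a \<Rightarrow> real)"
  shows "(\<Sum>e\<in>E. b e e) = (\<Sum>f\<in>F. b f f)"
proof -
  have l1: "linear (b x)" for x using b by (simp add: bilinear_def)
  have l2: "linear (\<lambda>x. b x y)" for y using b by (simp add: bilinear_def)
  have "(\<Sum>e\<in>E. b e e) = (\<Sum>e\<in>E. \<Sum>f\<in>F. ip e f * b f e)"
  proof (rule sum.cong[OF refl])
    fix e
    have "b e e = b (\<Sum>f\<in>F. ip e f *\<^sub>R f) e" using F by (simp add: orthonormal_expansion)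
    also have "\<dots> = (\<Sum>f\<in>F. ip e f * b f e)"
      by (simp add: linear_sum[OF l2] linear_scale[OF l2])
    finally show "b e e = (\<Sum>f\<in>F. ip e f * b f e)" .
  qed
  also have "\<dots> = (\<Sum>f\<in>F. \<Sum>e\<in>E. ip f e * b f e)"
    by (subst sum.swap) (simp add: ip_sym)
  also have "\<dots> = (\<Sum>f\<in>F. b f f)"
  proof (rule sum.cong[OF refl])
    fix f
    have "b f f = b f (\<Sum>e\<in>E. ip f e *\<^sub>R e)" using E by (simp add: orthonormal_expansion)
    also have "\<dots> = (\<Sum>e\<in>E. ip f e * b f e)"
      by (simp add: linear_sum[OF l1] linear_scale[OF l1])
    finally show "(\<Sum>e\<in>E. ip f e * b f e) = b f f" by simp
  qed
  finally show ?thesis .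
qed

lemma trace_on_orthonormal:
  assumes "orthonormal E" "linear f" "\<And>x. x \<in> span E \<Longrightarrow> f x \<in> span E"
  shows "trace_on (span E) f = (\<Sum>e\<in>E. ip (f e) e)"
proof -
  have fin: "finite E" using assms(1) by (simp add: orthonormal_def)
  have "f i = (\<Sum>j\<in>E. ip (f i) j *\<^sub>R id j)" if "i \<in> E" for i
    using orthonormal_expansion[OF assms(1)] assms(3) that by (simp add: span_base)
  then show ?thesis
    using trace_on_family[OF fin inj_on_id, of f "\<lambda>i j. ip (f i) j"]
      orthonormal_independent[OF assms(1)] assms(2) by simp
qed

end

section \<open>Ricci curvature of a metric Lie algebra\<close>

lemma lie_skew:
  assumes "lie_algebra br"
  shows "br x y = - br y x"
proof -
  have b: "bilinear br" and z: "br x x = 0" for x using assms by (auto simp: lie_algebra_def)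
  have "br (x + y) (x + y) = br x y + br y x"
    unfolding bilinear_ladd[OF b] bilinear_radd[OF b] by (simp add: z)
  then have "br x y + br y x = 0" using z[of "x + y"] by simp
  then show ?thesis by (simp add: eq_neg_iff_add_eq_0)
qed

lemma lie_derivation:
  assumes lie: "lie_algebra br"
  shows "br x (br y z) = br (br x y) z + br y (br x z)"
proof -
  have b: "bilinear br" using lie by (simp add: lie_algebra_def)
  have "br x (br y z) + br y (br z x) + br z (br x y) = 0"
    using lie by (simp add: lie_algebra_def)
  moreover have "br y (br z x) = - br y (br x z)"
    using lie_skew[OF lie, of z x] by (simp add: bilinear_rneg[OF b])
  moreover have "br z (br x y) = - br (br x y) z" by (rule lie_skew[OF lie])
  ultimately show ?thesis by (simp add: algebra_simps)
qed

locale metric_lie_algebra =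
  fixes br :: "'a::real_vector \<Rightarrow> 'a \<Rightarrow> 'a" and ip :: "'a \<Rightarrow> 'a \<Rightarrow> real"
  assumes lie: "lie_algebra br" and inner: "is_inner_product ip"
begin

sublocale inner_product_form ip
  using lie inner by unfold_locales (auto simp: lie_algebra_def)

lemma br_bilinear: "bilinear br" using lie by (simp add: lie_algebra_def)
lemma br_linear: "linear (br x)" "linear (\<lambda>x. br x y)"
  using br_bilinear by (auto simp: bilinear_def)

lemmas br_simps = linear_add[OF br_linear(1)] linear_add[OF br_linear(2)]
  linear_diff[OF br_linear(1)] linear_diff[OF br_linear(2)]
  linear_scale[OF br_linear(1)] linear_scale[OF br_linear(2)]
  linear_sum[OF br_linear(1)] linear_sum[OF br_linear(2)]
  linear_0[OF br_linear(1)] linear_0[OF br_linear(2)]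

lemma br_skew: "br x y = - br y x" by (rule lie_skew[OF lie])

abbreviation h :: 'a where "h \<equiv> mean_curvature_vector br ip"

text \<open>
  The vector with coordinates \<open>Tr ad e\<close> in an orthonormal basis represents the functional
  \<open>Tr ad\<close>, and positivity of the inner product makes it unique.
\<close>

lemma mean_curvature_vector:
  assumes E: "orthonormal E" "span E = UNIV"
  shows "ip h x = (\<Sum>e\<in>E. ip (br x e) e)"
proof -
  have tr: "trace_on UNIV (br x) = (\<Sum>e\<in>E. ip (br x e) e)" for x
    using trace_on_orthonormal[OF E(1), of "br x"] E(2) br_linear by simp
  define g where "g = (\<Sum>e\<in>E. trace_on UNIV (br e) *\<^sub>R e)"
  have g: "ip g x = trace_on UNIV (br x)" for x
  proof -
    have "ip g x = (\<Sum>e'\<in>E. ip g e' * ip x e')"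
      using parseval[OF E(1), of g x] E(2) by simp
    also have "\<dots> = (\<Sum>e'\<in>E. trace_on UNIV (br e') * ip x e')"
      unfolding g_def using orthonormal_coefficient[OF E(1)] by (intro sum.cong) auto
    also have "\<dots> = (\<Sum>e\<in>E. \<Sum>e'\<in>E. ip x e' * ip (br e' e) e)"
      unfolding tr sum_distrib_right by (subst sum.swap) (simp add: mult.commute)
    also have "\<dots> = (\<Sum>e\<in>E. ip (br (\<Sum>e'\<in>E. ip x e' *\<^sub>R e') e) e)"
      by (simp add: br_simps ip_simps)
    also have "\<dots> = trace_on UNIV (br x)"
      using tr orthonormal_expansion[OF E(1), of x] E(2) by simp
    finally show ?thesis .
  qed
  have "h = g"
    unfolding mean_curvature_vector_def
  proof (rule the_equality)
    fix k assume "\<forall>x. ip k x = trace_on UNIV (br x)"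
    then have "ip (k - g) (k - g) = 0" using g by (simp add: ip_simps)
    then show "k = g" using ip_pos[of "k - g"] by (cases "k = g") auto
  qed (simp add: g)
  then show ?thesis using g tr by simp
qed

text \<open>
  A bilinear form with the Ricci form on its diagonal; bilinearity reduces the Ricci form of a sum to
  its values on pairs of basis vectors.
\<close>

definition ricci_polar :: "'a set \<Rightarrow> 'a \<Rightarrow> 'a \<Rightarrow> real" where
  "ricci_polar E x y =
     - ip (br h x) y - 1/2 * (\<Sum>e\<in>E. ip (br x (br y e)) e)
     - 1/2 * (\<Sum>e\<in>E. ip (br x e) (br y e))
     + 1/4 * (\<Sum>e\<in>E. \<Sum>e'\<in>E. ip (br e e') x * ip (br e e') y)"

text \<open>
  Each of the sums over the basis is the trace of a bilinear form, hence may be computed in any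
  orthonormal basis, for instance one adapted to an ideal or to the structure constants.
\<close>

lemma ric_eq_polar:
  assumes E: "orthonormal E" "span E = UNIV"
  shows "ric br ip x = ricci_polar E x x"
proof -
  define F where "F = (SOME E. is_orthonormal_basis ip E)"
  have "is_orthonormal_basis ip F"
    unfolding F_def using E by (intro someI[of "is_orthonormal_basis ip"]) (simp add: orthonormal_basis_iff)
  then have F: "orthonormal F" "span F = UNIV" by (simp_all add: orthonormal_basis_iff)
  have lin: "linear (\<lambda>z. br x (br x z))" 
    using linear_compose[OF br_linear(1)[of x] br_linear(1)[of x]] by (simp add: o_def)
  have "killing_form br x x = (\<Sum>e\<in>E. ip (br x (br x e)) e)"
    unfolding killing_form_def using trace_on_orthonormal[OF E(1) lin] E(2) by simp
  moreover have "(\<Sum>e\<in>F. ip (br x e) (br x e)) = (\<Sum>e\<in>E. ip (br x e) (br x e))"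
    by (rule bilinear_trace_independent[OF F E])
      (auto simp: bilinear_def br_simps ip_simps intro!: linearI)
  moreover have "(\<Sum>e\<in>F. \<Sum>e'\<in>F. (ip (br e e') x)\<^sup>2) = (\<Sum>e\<in>E. \<Sum>e'\<in>E. (ip (br e e') x)\<^sup>2)"
  proof -
    have "(\<Sum>e\<in>F. \<Sum>e'\<in>F. (ip (br e e') x)\<^sup>2) = (\<Sum>e\<in>F. \<Sum>e'\<in>E. (ip (br e e') x)\<^sup>2)"
      unfolding power2_eq_square
      by (intro sum.cong bilinear_trace_independent[OF F E] refl)
        (auto simp: bilinear_def br_simps ip_simps algebra_simps intro!: linearI)
    also have "\<dots> = (\<Sum>e'\<in>E. \<Sum>e\<in>F. (ip (br e e') x)\<^sup>2)" by (rule sum.swap)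
    also have "\<dots> = (\<Sum>e'\<in>E. \<Sum>e\<in>E. (ip (br e e') x)\<^sup>2)"
      unfolding power2_eq_square
      by (intro sum.cong bilinear_trace_independent[OF F E] refl)
        (auto simp: bilinear_def br_simps ip_simps algebra_simps intro!: linearI)
    also have "\<dots> = (\<Sum>e\<in>E. \<Sum>e'\<in>E. (ip (br e e') x)\<^sup>2)" by (rule sum.swap)
    finally show ?thesis .
  qed
  ultimately show ?thesis
    unfolding ric_def Let_def F_def[symmetric] ricci_polar_def by (simp add: power2_eq_square)
qed

lemma ricci_polar_bilinear: "bilinear (ricci_polar E)"
  unfolding bilinear_def ricci_polar_def
  by (intro conjI allI linearI)
    (simp_all add: br_simps ip_simps sum.distrib sum_distrib_left algebra_simps)

end

section \<open>Abelian ideals under negative Ricci curvature\<close>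

context metric_lie_algebra
begin

text \<open>
  Extend an orthonormal basis \<open>E1\<close> of \<open>A\<close> to one, \<open>E\<close>, of the whole algebra and sum the Ricci
  curvature over \<open>E1\<close>. The Killing form vanishes on \<open>A\<close> since \<open>(ad a)^2 = 0\<close>. With \<open>q e e'\<close> the
  squared length of the \<open>A\<close>-component of \<open>[e, e']\<close>, the remaining terms are
  \<open>-1/2\<close> times the sum of \<open>q\<close> over \<open>E1 \<times> E\<close> plus \<open>1/4\<close> times the sum over \<open>E \<times> E\<close>. Since \<open>A\<close> is
  abelian, the mixed pairs, which occur twice in the second sum, already compensate the first.
  So the total is at least \<open>- Tr (ad h | A)\<close>.
\<close>

lemma abelian_ideal_trace_pos:
  assumes neg: "negative_ricci br ip"
    and A: "lie_ideal br A" "\<And>x y. x \<in> A \<Longrightarrow> y \<in> A \<Longrightarrow> br x y = 0"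
    and B: "finite B" "span B = A" and nz: "A \<noteq> {0}"
  shows "trace_on A (br h) > 0"
proof -
  have "orthonormal {}" by (simp add: orthonormal_def)
  then obtain E1 where E1: "orthonormal E1" "span E1 = A"
    using orthonormal_extend[OF _ B(1)] B(2) by (metis sup_bot_left)
  obtain E where E: "orthonormal E" "span E = UNIV" "E1 \<subseteq> E"
    using orthonormal_basis_extend[OF E1(1)] by blast
  have fin: "finite E" "finite E1" using E(1) E1(1) by (auto simp: orthonormal_def)
  have mem: "a \<in> A" if "a \<in> E1" for a using E1(2) that span_base by blast
  have ideal: "br x a \<in> A" "br a x \<in> A" if "a \<in> A" for a x
  proof -
    show 1: "br x a \<in> A" using A(1) that by (simp add: lie_ideal_def)
    have "subspace A" using A(1) by (simp add: lie_ideal_def)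
    then show "br a x \<in> A" using 1 br_skew[of a x] subspace_neg by metis
  qed
  define q where "q e e' = (\<Sum>a\<in>E1. (ip (br e e') a)\<^sup>2)" for e e'
  have q_nonneg: "q e e' \<ge> 0" for e e' unfolding q_def by (intro sum_nonneg) simp
  have q_sym: "q e e' = q e' e" for e e'
    unfolding q_def br_skew[of e e'] by (simp add: linear_neg[OF ip_linear(2)])
  have q_A: "q a e = ip (br a e) (br a e)" if "a \<in> E1" for a e
    using parseval[OF E1(1), of "br a e" "br a e"] ideal(2)[OF mem[OF that]] E1(2)
    by (simp add: q_def power2_eq_square)
  have ric_a: "ric br ip a = - ip (br h a) a - 1/2 * (\<Sum>e\<in>E. q a e)
      + 1/4 * (\<Sum>e\<in>E. \<Sum>e'\<in>E. (ip (br e e') a)\<^sup>2)" if a: "a \<in> E1" for a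
  proof -
    have "br a (br a e) = 0" for e using A(2) mem[OF a] ideal(2) by blast
    then show ?thesis
      unfolding ric_eq_polar[OF E(1,2)] ricci_polar_def
      using q_A[OF a] by (simp add: ip_simps power2_eq_square)
  qed
  \<comment> \<open>Pairs inside \<open>E1\<close> contribute nothing; mixed pairs occur twice.\<close>
  have "(\<Sum>e\<in>E. \<Sum>e'\<in>E. q e e') \<ge> 2 * (\<Sum>a\<in>E1. \<Sum>e\<in>E. q a e)"
  proof -
    have zero: "(\<Sum>a\<in>E1. \<Sum>e\<in>E1. q a e) = 0"
      using A(2) mem by (simp add: q_def ip_simps)
    have E1q: "(\<Sum>a\<in>E1. \<Sum>e\<in>E. q a e) = (\<Sum>a\<in>E1. \<Sum>e\<in>E - E1. q a e)"
      using zero by (simp add: sum.distrib sum.subset_diff[OF E(3) fin(1)])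
    have "(\<Sum>e\<in>E. \<Sum>e'\<in>E. q e e')
        = (\<Sum>e\<in>E - E1. \<Sum>e'\<in>E - E1. q e e') + (\<Sum>e\<in>E - E1. \<Sum>a\<in>E1. q e a)
          + (\<Sum>a\<in>E1. \<Sum>e\<in>E. q a e)"
      by (simp add: sum.distrib sum.subset_diff[OF E(3) fin(1)])
    also have "(\<Sum>e\<in>E - E1. \<Sum>a\<in>E1. q e a) = (\<Sum>a\<in>E1. \<Sum>e\<in>E - E1. q a e)"
      by (subst sum.swap) (simp add: q_sym)
    finally show ?thesis using E1q by (simp add: sum_nonneg q_nonneg)
  qed
  moreover have "(\<Sum>a\<in>E1. ric br ip a) = - (\<Sum>a\<in>E1. ip (br h a) a)
      - 1/2 * (\<Sum>a\<in>E1. \<Sum>e\<in>E. q a e) + 1/4 * (\<Sum>e\<in>E. \<Sum>e'\<in>E. q e e')"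
  proof -
    have "(\<Sum>a\<in>E1. \<Sum>e\<in>E. \<Sum>e'\<in>E. (ip (br e e') a)\<^sup>2) = (\<Sum>e\<in>E. \<Sum>e'\<in>E. q e e')"
      unfolding q_def by (subst sum.swap, rule sum.cong[OF refl], subst sum.swap, rule refl)
    then show ?thesis
      by (simp add: ric_a sum.distrib sum_subtractf sum_negf flip: sum_distrib_left sum_divide_distrib)
  qed
  moreover have "(\<Sum>a\<in>E1. ric br ip a) < 0"
  proof -
    have "E1 \<noteq> {}" using E1(2) nz by auto
    moreover have "ric br ip a < 0" if "a \<in> E1" for a
    proof -
      have "ip a a = 1" using E1(1) that by (simp add: orthonormal_def)
      then have "a \<noteq> 0" by (auto simp: ip_simps)
      then show ?thesis using neg by (simp add: negative_ricci_def)
    qed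
    ultimately show ?thesis using sum_strict_mono[OF fin(2), of "ric br ip" "\<lambda>_. 0"] by simp
  qed
  moreover have "trace_on A (br h) = (\<Sum>a\<in>E1. ip (br h a) a)"
    using trace_on_orthonormal[OF E1(1) br_linear(1)[of h]] E1(2) ideal(1) by simp
  ultimately show ?thesis by linarith
qed

end

section \<open>Ricci curvature from structure constants\<close>

text \<open>
  The entries of the polarised Ricci form in an orthonormal basis \<open>e\<close> with
  \<open>[e_i, e_j] = \<Sum>k. C i j k e_k\<close>. They are polynomials in \<open>C\<close>, so they pass to limits.
\<close>

definition ricci_coeff :: "'i set \<Rightarrow> ('i \<Rightarrow> 'i \<Rightarrow> 'i \<Rightarrow> real) \<Rightarrow> 'i \<Rightarrow> 'i \<Rightarrow> real" where
  "ricci_coeff I C i j =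
     - (\<Sum>k\<in>I. (\<Sum>l\<in>I. C k l l) * C k i j)
     - 1/2 * (\<Sum>k\<in>I. \<Sum>l\<in>I. C j k l * C i l k)
     - 1/2 * (\<Sum>k\<in>I. \<Sum>l\<in>I. C i k l * C j k l)
     + 1/4 * (\<Sum>k\<in>I. \<Sum>l\<in>I. C k l i * C k l j)"

context metric_lie_algebra
begin

lemma ric_structure_constants:
  fixes e :: "'i \<Rightarrow> 'a"
  assumes I: "finite I"
    and on: "\<And>i j. i \<in> I \<Longrightarrow> j \<in> I \<Longrightarrow> ip (e i) (e j) = (if i = j then 1 else 0)"
    and sp: "span (e ` I) = UNIV"
    and C: "\<And>i j. i \<in> I \<Longrightarrow> j \<in> I \<Longrightarrow> br (e i) (e j) = (\<Sum>k\<in>I. C i j k *\<^sub>R e k)"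
  shows "ric br ip (\<Sum>i\<in>I. x i *\<^sub>R e i) = (\<Sum>i\<in>I. \<Sum>j\<in>I. x i * x j * ricci_coeff I C i j)"
proof -
  have inj: "inj_on e I"
    using on by (metis inj_onI zero_neq_one)
  have E: "orthonormal (e ` I)"
    unfolding orthonormal_def using I on inj by (auto simp: inj_on_def)
  have sumE: "(\<Sum>u\<in>e ` I. f u) = (\<Sum>i\<in>I. f (e i))" for f :: "'a \<Rightarrow> real"
    using inj by (simp add: sum.reindex)
  have ip_e: "ip (\<Sum>k\<in>I. a k *\<^sub>R e k) (e l) = a l" if "l \<in> I" for a l
  proof -
    have "ip (\<Sum>k\<in>I. a k *\<^sub>R e k) (e l) = (\<Sum>k\<in>I. if k = l then a k else 0)"
      unfolding ip_simps using on that by (intro sum.cong) auto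
    then show ?thesis using I that by simp
  qed
  have CC: "ip (br (e i) (e j)) (e k) = C i j k" if "i \<in> I" "j \<in> I" "k \<in> I" for i j k
    using C ip_e that by simp
  have par: "ip u w = (\<Sum>k\<in>I. ip u (e k) * ip w (e k))" for u w
    using parseval[OF E, of u w] sp by (simp add: sumE)
  have h_e: "ip h (e k) = (\<Sum>l\<in>I. C k l l)" if "k \<in> I" for k
    using mean_curvature_vector[OF E sp, of "e k"] CC that by (simp add: sumE)
  have h: "h = (\<Sum>k\<in>I. (\<Sum>l\<in>I. C k l l) *\<^sub>R e k)"
  proof -
    have "h = (\<Sum>u\<in>e ` I. ip h u *\<^sub>R u)" using orthonormal_expansion[OF E] sp by simp
    also have "\<dots> = (\<Sum>k\<in>I. ip h (e k) *\<^sub>R e k)" using inj by (simp add: sum.reindex)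
    also have "\<dots> = (\<Sum>k\<in>I. (\<Sum>l\<in>I. C k l l) *\<^sub>R e k)" using h_e by (intro sum.cong) auto
    finally show ?thesis .
  qed
  have polar: "ricci_polar (e ` I) (e i) (e j) = ricci_coeff I C i j" if ij: "i \<in> I" "j \<in> I" for i j
  proof -
    have "ip (br h (e i)) (e j) = (\<Sum>k\<in>I. (\<Sum>l\<in>I. C k l l) * C k i j)"
      unfolding h using CC ij by (simp add: br_simps ip_simps)
    moreover have "(\<Sum>u\<in>e ` I. ip (br (e i) (br (e j) u)) u) = (\<Sum>k\<in>I. \<Sum>l\<in>I. C j k l * C i l k)"
      unfolding sumE
    proof (rule sum.cong[OF refl])
      fix k assume k: "k \<in> I"
      show "ip (br (e i) (br (e j) (e k))) (e k) = (\<Sum>l\<in>I. C j k l * C i l k)"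
        unfolding C[OF ij(2) k] using CC ij k by (simp add: br_simps ip_simps)
    qed
    moreover have "(\<Sum>u\<in>e ` I. ip (br (e i) u) (br (e j) u)) = (\<Sum>k\<in>I. \<Sum>l\<in>I. C i k l * C j k l)"
      unfolding sumE
    proof (rule sum.cong[OF refl])
      fix k assume k: "k \<in> I"
      show "ip (br (e i) (e k)) (br (e j) (e k)) = (\<Sum>l\<in>I. C i k l * C j k l)"
        unfolding par[of "br (e i) (e k)" "br (e j) (e k)"] using CC ij k by (intro sum.cong) auto
    qed
    moreover have "(\<Sum>u\<in>e ` I. \<Sum>v\<in>e ` I. ip (br u v) (e i) * ip (br u v) (e j))
        = (\<Sum>k\<in>I. \<Sum>l\<in>I. C k l i * C k l j)"
      unfolding sumE using CC ij by simp
    ultimately show ?thesis by (simp add: ricci_polar_def ricci_coeff_def)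
  qed
  have l1: "linear (ricci_polar (e ` I) u)" and l2: "linear (\<lambda>u. ricci_polar (e ` I) u w)" for u w
    using ricci_polar_bilinear[of "e ` I"] by (auto simp: bilinear_def)
  have "ric br ip (\<Sum>i\<in>I. x i *\<^sub>R e i)
      = (\<Sum>i\<in>I. \<Sum>j\<in>I. x i * x j * ricci_polar (e ` I) (e i) (e j))"
    unfolding ric_eq_polar[OF E sp]
    by (simp add: linear_sum[OF l1] linear_scale[OF l1] linear_sum[OF l2] linear_scale[OF l2]
        sum_distrib_left, subst sum.swap, simp add: mult_ac)
  then show ?thesis using polar by simp
qed

end

text \<open>
  Diagonal dominance: by \<open>2 |x_i x_j| \<le> x_i^2 + x_j^2\<close> every off-diagonal entry is charged to the
  two diagonal entries in its row and column.
\<close>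

lemma quadratic_form_neg:
  fixes R :: "'i \<Rightarrow> 'i \<Rightarrow> real"
  assumes I: "finite I"
    and dom: "\<And>i. i \<in> I \<Longrightarrow> R i i + (\<Sum>j\<in>I - {i}. (\<bar>R i j\<bar> + \<bar>R j i\<bar>) / 2) < 0"
    and x: "i0 \<in> I" "x i0 \<noteq> 0"
  shows "(\<Sum>i\<in>I. \<Sum>j\<in>I. x i * x j * R i j) < 0"
proof -
  have le: "x i * x j * R i j \<le> (x i)\<^sup>2 * (\<bar>R i j\<bar> / 2) + (x j)\<^sup>2 * (\<bar>R i j\<bar> / 2)" for i j
  proof -
    have "2 * (\<bar>x i\<bar> * \<bar>x j\<bar>) \<le> (x i)\<^sup>2 + (x j)\<^sup>2"
      using sum_squares_bound[of "\<bar>x i\<bar>" "\<bar>x j\<bar>"] by simp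
    then have "\<bar>x i * x j\<bar> * \<bar>R i j\<bar> \<le> ((x i)\<^sup>2 + (x j)\<^sup>2) / 2 * \<bar>R i j\<bar>"
      by (intro mult_right_mono) (auto simp: abs_mult)
    moreover have "x i * x j * R i j \<le> \<bar>x i * x j\<bar> * \<bar>R i j\<bar>"
      by (metis abs_ge_self abs_mult)
    ultimately show ?thesis by (simp add: field_simps)
  qed
  have split: "(\<Sum>j\<in>I. f j) = f i + (\<Sum>j\<in>I - {i}. f j)" if "i \<in> I" for f :: "'i \<Rightarrow> real" and i
    using I that by (simp add: sum.remove)
  let ?g = "\<lambda>i j. if i = j then 0 else \<bar>R i j\<bar> / 2"
  have "(\<Sum>i\<in>I. \<Sum>j\<in>I. x i * x j * R i j)
      \<le> (\<Sum>i\<in>I. (x i)\<^sup>2 * R i i + (\<Sum>j\<in>I. (x i)\<^sup>2 * ?g i j + (x j)\<^sup>2 * ?g i j))"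
  proof (rule sum_mono)
    fix i assume i: "i \<in> I"
    have "(\<Sum>j\<in>I - {i}. x i * x j * R i j) \<le> (\<Sum>j\<in>I - {i}. (x i)\<^sup>2 * ?g i j + (x j)\<^sup>2 * ?g i j)"
      using le by (intro sum_mono) auto
    then show "(\<Sum>j\<in>I. x i * x j * R i j)
        \<le> (x i)\<^sup>2 * R i i + (\<Sum>j\<in>I. (x i)\<^sup>2 * ?g i j + (x j)\<^sup>2 * ?g i j)"
      unfolding split[OF i] by (simp add: power2_eq_square)
  qed
  also have "\<dots> = (\<Sum>i\<in>I. (x i)\<^sup>2 * (R i i + (\<Sum>j\<in>I. ?g i j + ?g j i)))"
  proof -
    have "(\<Sum>i\<in>I. \<Sum>j\<in>I. (x j)\<^sup>2 * ?g i j) = (\<Sum>i\<in>I. \<Sum>j\<in>I. (x i)\<^sup>2 * ?g j i)"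
      by (rule sum.swap)
    then show ?thesis by (simp only: sum.distrib distrib_left sum_distrib_left add.assoc)
  qed
  also have "\<dots> = (\<Sum>i\<in>I. (x i)\<^sup>2 * (R i i + (\<Sum>j\<in>I - {i}. (\<bar>R i j\<bar> + \<bar>R j i\<bar>) / 2)))"
  proof (rule sum.cong[OF refl])
    fix i assume i: "i \<in> I"
    have "(\<Sum>j\<in>I - {i}. ?g i j + ?g j i) = (\<Sum>j\<in>I - {i}. (\<bar>R i j\<bar> + \<bar>R j i\<bar>) / 2)"
      by (intro sum.cong) (auto simp: add_divide_distrib)
    then show "(x i)\<^sup>2 * (R i i + (\<Sum>j\<in>I. ?g i j + ?g j i))
      = (x i)\<^sup>2 * (R i i + (\<Sum>j\<in>I - {i}. (\<bar>R i j\<bar> + \<bar>R j i\<bar>) / 2))"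
      unfolding split[OF i] by simp
  qed
  also have "\<dots> < (\<Sum>i\<in>I. 0)"
  proof (rule sum_strict_mono_ex1[OF I])
    show "\<forall>i\<in>I. (x i)\<^sup>2 * (R i i + (\<Sum>j\<in>I - {i}. (\<bar>R i j\<bar> + \<bar>R j i\<bar>) / 2)) \<le> 0"
      using dom by (auto intro!: mult_nonneg_nonpos simp: less_imp_le)
    show "\<exists>i\<in>I. (x i)\<^sup>2 * (R i i + (\<Sum>j\<in>I - {i}. (\<bar>R i j\<bar> + \<bar>R j i\<bar>) / 2)) < 0"
      using dom[OF x(1)] x by (intro bexI[of _ i0] mult_pos_neg) auto
  qed
  finally show ?thesis by simp
qed

lemma eventually_quadratic_form_neg:
  fixes R :: "'t \<Rightarrow> 'i \<Rightarrow> 'i \<Rightarrow> real"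
  assumes I: "finite I"
    and lim: "\<And>i j. i \<in> I \<Longrightarrow> j \<in> I \<Longrightarrow> ((\<lambda>t. R t i j) \<longlongrightarrow> R0 i j) F"
    and off: "\<And>i j. i \<in> I \<Longrightarrow> j \<in> I \<Longrightarrow> i \<noteq> j \<Longrightarrow> R0 i j = 0"
    and diag: "\<And>i. i \<in> I \<Longrightarrow> R0 i i < 0"
  shows "\<forall>\<^sub>F t in F. \<forall>x. (\<exists>i\<in>I. x i \<noteq> 0) \<longrightarrow> (\<Sum>i\<in>I. \<Sum>j\<in>I. x i * x j * R t i j) < 0"
proof -
  have "\<forall>\<^sub>F t in F. \<forall>i\<in>I. R t i i + (\<Sum>j\<in>I - {i}. (\<bar>R t i j\<bar> + \<bar>R t j i\<bar>) / 2) < 0"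
  proof (rule eventually_ball_finite[OF I], rule ballI)
    fix i assume i: "i \<in> I"
    have "((\<lambda>t. R t i i + (\<Sum>j\<in>I - {i}. (\<bar>R t i j\<bar> + \<bar>R t j i\<bar>) / 2))
        \<longlongrightarrow> R0 i i + (\<Sum>j\<in>I - {i}. (\<bar>R0 i j\<bar> + \<bar>R0 j i\<bar>) / 2)) F"
      using i by (intro tendsto_intros lim) auto
    moreover have "(\<Sum>j\<in>I - {i}. (\<bar>R0 i j\<bar> + \<bar>R0 j i\<bar>) / 2) = 0"
      using off i by (intro sum.neutral) auto
    ultimately show "\<forall>\<^sub>F t in F. R t i i + (\<Sum>j\<in>I - {i}. (\<bar>R t i j\<bar> + \<bar>R t j i\<bar>) / 2) < 0"
      using order_tendstoD(2) diag[OF i] by simp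
  qed
  then show ?thesis
  proof (rule eventually_mono, intro allI impI)
    fix t and x :: "'i \<Rightarrow> real"
    assume "\<forall>i\<in>I. R t i i + (\<Sum>j\<in>I - {i}. (\<bar>R t i j\<bar> + \<bar>R t j i\<bar>) / 2) < 0" "\<exists>i\<in>I. x i \<noteq> 0"
    then show "(\<Sum>i\<in>I. \<Sum>j\<in>I. x i * x j * R t i j) < 0"
      using quadratic_form_neg[OF I, of "R t"] by blast
  qed
qed

text \<open>
  Structure constants of the extension of an algebra with constants \<open>T\<close> by a vector that acts on
  its basis diagonally with eigenvalues \<open>d\<close>; the added vector has index \<open>0\<close>.
\<close>

definition extension_coeff ::
  "(nat \<Rightarrow> real) \<Rightarrow> (nat \<Rightarrow> nat \<Rightarrow> nat \<Rightarrow> real) \<Rightarrow> nat \<Rightarrow> nat \<Rightarrow> nat \<Rightarrow> real" where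
  "extension_coeff d T i j k =
     (if i = 0 then (if j \<noteq> 0 \<and> k = j then d j else 0)
      else if j = 0 then (if k = i then - d i else 0)
      else if k = 0 then 0 else T i j k)"

text \<open>
  The hypotheses \<open>unique_out\<close> and \<open>unique_in\<close> say that a bracket of two basis vectors is a multiple
  of a basis vector and that \<open>[e_i, e_j]\<close> and \<open>[e_i, e_j']\<close> have no common component when
  \<open>j \<noteq> j'\<close>; hence no two different indices meet in the same product, and the form is diagonal.
  By \<open>upper\<close>, \<open>ad e_i\<close> is strictly triangular for \<open>i > 0\<close>, so traces and the Killing form only see
  the added vector. The terms \<open>(d i)^2\<close> cancel, because a diagonal operator is self-adjoint.
\<close>

lemma ricci_coeff_diagonal_extension:
  fixes T :: "nat \<Rightarrow> nat \<Rightarrow> nat \<Rightarrow> real"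
  assumes skew: "\<And>i j k. T i j k = - T j i k"
    and upper: "\<And>i j k. T i j k \<noteq> 0 \<Longrightarrow> i < k \<and> j < k"
    and unique_out: "\<And>i j k k'. T i j k \<noteq> 0 \<Longrightarrow> T i j k' \<noteq> 0 \<Longrightarrow> k = k'"
    and unique_in: "\<And>i j j' k. T i j k \<noteq> 0 \<Longrightarrow> T i j' k \<noteq> 0 \<Longrightarrow> j = j'"
    and ij: "i \<le> n" "j \<le> n"
  shows "ricci_coeff {..n} (extension_coeff d T) i j =
    (if i \<noteq> j then 0 else if i = 0 then - (\<Sum>k\<in>{1..n}. (d k)\<^sup>2)
     else - (\<Sum>k\<in>{1..n}. d k) * d i
       - 1/2 * (\<Sum>k\<in>{1..n}. \<Sum>l\<in>{1..n}. (T i k l)\<^sup>2)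
       + 1/4 * (\<Sum>k\<in>{1..n}. \<Sum>l\<in>{1..n}. (T k l i)\<^sup>2))"
proof -
  let ?C = "extension_coeff d T"
  have S: "(\<Sum>k\<le>n. f k) = f 0 + (\<Sum>k\<in>{1..n}. f k)" for f :: "nat \<Rightarrow> real"
  proof -
    have "{..n} = insert 0 {1..n}" by auto
    then show ?thesis by simp
  qed
  have diag0: "T k l l = 0" "T l k l = 0" for k l using upper by blast+
  have C0: "?C 0 j k = (if j \<noteq> 0 \<and> k = j then d j else 0)" for j k by (simp add: extension_coeff_def)
  have Ci0: "?C i 0 k = (if i \<noteq> 0 \<and> k = i then - d i else 0)" for i k by (simp add: extension_coeff_def)
  have Cij0: "?C i j 0 = 0" for i j by (simp add: extension_coeff_def)
  have CT: "?C i j k = T i j k" if "i > 0" "j > 0" "k > 0" for i j k using that by (simp add: extension_coeff_def)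
  have h: "(\<Sum>l\<le>n. ?C k l l) = (if k = 0 then (\<Sum>l\<in>{1..n}. d l) else 0)" for k
  proof (cases "k = 0")
    case False
    have "(\<Sum>l\<in>{1..n}. ?C k l l) = 0"
      using False diag0 by (intro sum.neutral) (auto simp: extension_coeff_def)
    then show ?thesis unfolding S Cij0 using False by simp
  qed (simp add: S C0)
  have t1: "(\<Sum>k\<le>n. (\<Sum>l\<le>n. ?C k l l) * ?C k i j)
      = (if i \<noteq> 0 \<and> j = i then (\<Sum>l\<in>{1..n}. d l) * d i else 0)"
    unfolding h by (subst S) (simp add: C0)
  have t2: "(\<Sum>k\<le>n. \<Sum>l\<le>n. ?C j k l * ?C i l k)
      = (if i = 0 \<and> j = 0 then (\<Sum>k\<in>{1..n}. (d k)\<^sup>2) else 0)"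
  proof (cases "i = 0 \<and> j = 0")
    case True
    have "(\<Sum>l\<le>n. ?C 0 k l * ?C 0 l k) = (if k = 0 then 0 else (d k)\<^sup>2)" if "k \<le> n" for k
    proof -
      have "(\<Sum>l\<le>n. ?C 0 k l * ?C 0 l k) = (\<Sum>l\<le>n. if l = k then (if k = 0 then 0 else (d k)\<^sup>2) else 0)"
        by (intro sum.cong) (auto simp: C0 power2_eq_square)
      then show ?thesis using that by simp
    qed
    then have "(\<Sum>k\<le>n. \<Sum>l\<le>n. ?C 0 k l * ?C 0 l k) = (\<Sum>k\<le>n. if k = 0 then 0 else (d k)\<^sup>2)"
      by (intro sum.cong) auto
    then show ?thesis unfolding S using True by simp
  next
    case False
    have "?C j k l * ?C i l k = 0" for k l
    proof (rule ccontr)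
      assume nz: "?C j k l * ?C i l k \<noteq> 0"
      then have kl: "k \<noteq> 0" "l \<noteq> 0" using Cij0 by (metis mult_eq_0_iff)+
      show False
      proof (cases "i = 0 \<or> j = 0")
        case True
        then have "k = l" using nz kl by (auto simp: C0 split: if_splits)
        then show False using nz kl False True diag0 by (auto simp: CT)
      next
        case False
        then have "T j k l \<noteq> 0" "T i l k \<noteq> 0" using nz kl by (auto simp: CT)
        then show False using upper by (meson less_asym)
      qed
    qed
    then have "(\<Sum>k\<le>n. \<Sum>l\<le>n. ?C j k l * ?C i l k) = 0" by (intro sum.neutral ballI)
    then show ?thesis using False by auto
  qed
  have t3: "(\<Sum>k\<le>n. \<Sum>l\<le>n. ?C i k l * ?C j k l)
      = (if i \<noteq> j then 0 else if i = 0 then (\<Sum>k\<in>{1..n}. (d k)\<^sup>2)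
         else (d i)\<^sup>2 + (\<Sum>k\<in>{1..n}. \<Sum>l\<in>{1..n}. (T i k l)\<^sup>2))"
  proof -
    consider (ne) "i \<noteq> j" | (zero) "i = 0" "j = 0" | (pos) "i = j" "i > 0" by auto
    then show ?thesis
    proof cases
      case ne
      have "?C i k l * ?C j k l = 0" for k l
      proof (rule ccontr)
        assume nz: "?C i k l * ?C j k l \<noteq> 0"
        have l: "l \<noteq> 0" using nz Cij0 by (metis mult_eq_0_iff)
        have k: "k \<noteq> 0" using nz ne by (cases "k = 0") (auto simp: Ci0 split: if_splits)
        show False
        proof (cases "i = 0 \<or> j = 0")
          case True
          then have "k = l" using nz by (auto simp: C0 split: if_splits)
          then show False using nz k l ne True diag0 by (auto simp: CT)
        next
          case False
          then have "T i k l \<noteq> 0" "T j k l \<noteq> 0" using nz k l by (auto simp: CT)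
          then have "T k i l \<noteq> 0" "T k j l \<noteq> 0" using skew[of i k l] skew[of j k l] by auto
          then show False using unique_in ne by blast
        qed
      qed
      then have "(\<Sum>k\<le>n. \<Sum>l\<le>n. ?C i k l * ?C j k l) = 0" by (intro sum.neutral ballI)
      then show ?thesis using ne by simp
    next
      case zero
      have "(\<Sum>l\<le>n. ?C 0 k l * ?C 0 k l) = (if k = 0 then 0 else (d k)\<^sup>2)" if "k \<le> n" for k
      proof -
        have "(\<Sum>l\<le>n. ?C 0 k l * ?C 0 k l) = (\<Sum>l\<le>n. if l = k then (if k = 0 then 0 else (d k)\<^sup>2) else 0)"
          by (intro sum.cong) (auto simp: C0 power2_eq_square)
        then show ?thesis using that by simp
      qed
      then have "(\<Sum>k\<le>n. \<Sum>l\<le>n. ?C 0 k l * ?C 0 k l) = (\<Sum>k\<le>n. if k = 0 then 0 else (d k)\<^sup>2)"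
        by (intro sum.cong) auto
      then show ?thesis unfolding S using zero by simp
    next
      case pos
      have "(\<Sum>l\<le>n. ?C i 0 l * ?C i 0 l) = (\<Sum>l\<le>n. if l = i then (d i)\<^sup>2 else 0)"
        using pos by (intro sum.cong) (auto simp: Ci0 power2_eq_square)
      then have "(\<Sum>l\<le>n. ?C i 0 l * ?C i 0 l) = (d i)\<^sup>2" using ij by simp
      moreover have "(\<Sum>l\<le>n. ?C i k l * ?C i k l) = (\<Sum>l\<in>{1..n}. (T i k l)\<^sup>2)" if "k \<in> {1..n}" for k
        unfolding S Cij0 using that pos by (auto simp: CT power2_eq_square intro!: sum.cong)
      ultimately have "(\<Sum>k\<le>n. \<Sum>l\<le>n. ?C i k l * ?C i k l)
          = (d i)\<^sup>2 + (\<Sum>k\<in>{1..n}. \<Sum>l\<in>{1..n}. (T i k l)\<^sup>2)"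
        by (subst S) simp
      then show ?thesis using pos by simp
    qed
  qed
  have t4: "(\<Sum>k\<le>n. \<Sum>l\<le>n. ?C k l i * ?C k l j)
      = (if i \<noteq> j \<or> i = 0 then 0
         else 2 * (d i)\<^sup>2 + (\<Sum>k\<in>{1..n}. \<Sum>l\<in>{1..n}. (T k l i)\<^sup>2))"
  proof -
    consider (ne) "i \<noteq> j" | (zero) "i = 0" "j = 0" | (pos) "i = j" "i > 0" by auto
    then show ?thesis
    proof cases
      case ne
      have "?C k l i * ?C k l j = 0" for k l
      proof (rule ccontr)
        assume nz: "?C k l i * ?C k l j \<noteq> 0"
        have ij: "i \<noteq> 0" "j \<noteq> 0" using nz Cij0 by (metis mult_eq_0_iff)+
        have kl: "k \<noteq> 0" "l \<noteq> 0"
          using nz ne by (cases "k = 0"; cases "l = 0"; auto simp: C0 Ci0 split: if_splits)+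
        then have "T k l i \<noteq> 0" "T k l j \<noteq> 0" using nz ij by (auto simp: CT)
        then show False using unique_out ne by blast
      qed
      then have "(\<Sum>k\<le>n. \<Sum>l\<le>n. ?C k l i * ?C k l j) = 0" by (intro sum.neutral ballI)
      then show ?thesis using ne by simp
    next
      case zero
      then show ?thesis by (simp add: Cij0)
    next
      case pos
      have "(\<Sum>l\<le>n. ?C 0 l i * ?C 0 l i) = (\<Sum>l\<le>n. if l = i then (d i)\<^sup>2 else 0)"
        using pos by (intro sum.cong) (auto simp: C0 power2_eq_square)
      then have a: "(\<Sum>l\<le>n. ?C 0 l i * ?C 0 l i) = (d i)\<^sup>2" using ij by simp
      have "(\<Sum>k\<in>{1..n}. ?C k 0 i * ?C k 0 i) = (\<Sum>k\<in>{1..n}. if k = i then (d i)\<^sup>2 else 0)"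
        using pos by (intro sum.cong) (auto simp: Ci0 power2_eq_square)
      then have b: "(\<Sum>k\<in>{1..n}. ?C k 0 i * ?C k 0 i) = (d i)\<^sup>2" using ij pos by simp
      have "(\<Sum>l\<le>n. ?C k l i * ?C k l i) = ?C k 0 i * ?C k 0 i + (\<Sum>l\<in>{1..n}. (T k l i)\<^sup>2)"
        if "k \<in> {1..n}" for k
        unfolding S using that pos by (auto simp: CT power2_eq_square intro!: sum.cong)
      then have "(\<Sum>k\<in>{1..n}. \<Sum>l\<le>n. ?C k l i * ?C k l i)
          = (d i)\<^sup>2 + (\<Sum>k\<in>{1..n}. \<Sum>l\<in>{1..n}. (T k l i)\<^sup>2)"
        using b by (simp add: sum.distrib)
      then have "(\<Sum>k\<le>n. \<Sum>l\<le>n. ?C k l i * ?C k l i)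
          = 2 * (d i)\<^sup>2 + (\<Sum>k\<in>{1..n}. \<Sum>l\<in>{1..n}. (T k l i)\<^sup>2)"
        using a by (subst S) simp
      then show ?thesis using pos by simp
    qed
  qed
  show ?thesis unfolding ricci_coeff_def t1 t2 t3 t4 by (simp add: field_simps)
qed

section \<open>Prescribed moments of positive monomials\<close>

lemma exp_quadratic_upper_bound:
  fixes t :: real
  assumes "\<bar>t\<bar> \<le> 1"
  shows "exp t \<le> 1 + t + t\<^sup>2"
proof (cases "t \<ge> 0")
  case True
  then show ?thesis using assms by (intro exp_bound) auto
next
  case False
  define u where "u = - t"
  have u: "u \<ge> 0" using False by (simp add: u_def)
  have low: "1 + u + u\<^sup>2 / 2 \<le> exp u" by (rule exp_lower_Taylor_quadratic[OF u])
  have pos: "1 + u + u\<^sup>2 / 2 > 0" using u by (intro add_pos_nonneg) auto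
  have "exp t = 1 / exp u" by (simp add: u_def exp_minus field_simps)
  also have "\<dots> \<le> 1 / (1 + u + u\<^sup>2 / 2)" using low pos by (intro divide_left_mono) auto
  also have "\<dots> \<le> 1 - u + u\<^sup>2"
  proof -
    have "(1 - u + u\<^sup>2) * (1 + u + u\<^sup>2 / 2) = 1 + (u ^ 2 / 2 + u ^ 3 / 2 + u ^ 4 / 2)"
      by (simp add: field_simps power2_eq_square power3_eq_cube power4_eq_xxxx)
    also have "\<dots> \<ge> 1" using u by simp
    finally show ?thesis using pos by (simp add: pos_divide_le_eq)
  qed
  finally show ?thesis by (simp add: u_def)
qed

text \<open>
  The tangent of \<open>exp\<close> at \<open>ln (2 c)\<close> has slope \<open>2 c\<close>; half of \<open>exp t\<close> is then left over, which
  bounds \<open>exp t\<close> on sublevel sets of \<open>exp t - c t\<close>.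
\<close>

lemma exp_minus_linear_lower_bound:
  fixes c t :: real
  assumes "c > 0"
  shows "exp t - c * t \<ge> exp t / 2 + c * (1 - ln (2 * c))"
proof -
  have "1 + (t - ln (2 * c)) \<le> exp (t - ln (2 * c))" by (rule exp_ge_add_one_self)
  also have "\<dots> = exp t / (2 * c)" using assms by (simp add: exp_diff)
  finally have "c * (1 + (t - ln (2 * c))) \<le> c * (exp t / (2 * c))"
    using assms by (intro mult_left_mono) auto
  then show ?thesis using assms by (simp add: field_simps)
qed

text \<open>
  The sum in the conclusion is the partial derivative in direction \<open>l\<close> of
  \<open>G(y) = \<Sum>w. exp (T y w) - c w * T y w\<close>, where \<open>T y w = \<Sum>l. y l * \<alpha> w l\<close>. As all \<open>c w\<close> are
  positive, \<open>G\<close> is bounded below, and the exponentials are bounded where \<open>G\<close> is. A point at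
  which \<open>G\<close> is within \<open>\<eta>\<close> of its infimum has small gradient, since a step of length \<open>t\<close>
  in one of the directions \<open>\<plusminus> l\<close> lowers \<open>G\<close> by at least \<open>t |D| - K A^2 t^2\<close>, where \<open>D\<close> is the partial
  derivative. Near-minimisers suffice, so the directions in which \<open>G\<close> is constant cause no trouble.
\<close>

lemma approximate_monomial_moments:
  fixes \<alpha> :: "'w \<Rightarrow> 'l \<Rightarrow> real" and c :: "'w \<Rightarrow> real"
  assumes W: "finite W" and L: "finite L" and c: "\<And>w. w \<in> W \<Longrightarrow> c w > 0" and \<epsilon>: "\<epsilon> > 0"
  obtains y where "\<And>l. l \<in> L \<Longrightarrow>
    \<bar>(\<Sum>w\<in>W. (exp (\<Sum>l\<in>L. y l * \<alpha> w l) - c w) * \<alpha> w l)\<bar> < \<epsilon>"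
proof -
  define T where "T y w = (\<Sum>l\<in>L. y l * \<alpha> w l)" for y w
  define G where "G y = (\<Sum>w\<in>W. exp (T y w) - c w * T y w)" for y
  define b where "b = (\<Sum>w\<in>W. c w * (1 - ln (2 * c w)))"
  have G_ge: "G y \<ge> (\<Sum>w\<in>W. exp (T y w)) / 2 + b" for y
  proof -
    have "G y \<ge> (\<Sum>w\<in>W. exp (T y w) / 2 + c w * (1 - ln (2 * c w)))"
      unfolding G_def using c exp_minus_linear_lower_bound by (intro sum_mono) auto
    then show ?thesis by (simp add: b_def sum.distrib sum_divide_distrib)
  qed
  have G_b: "G y \<ge> b" for y
    using G_ge[of y] sum_nonneg[of W "\<lambda>w. exp (T y w)"] by simp
  define g where "g = Inf (range G)"
  have bdd: "bdd_below (range G)" using G_b by (intro bdd_belowI[of _ b]) auto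
  have g_le: "g \<le> G y" for y unfolding g_def using bdd by (intro cInf_lower) auto
  have gb: "g \<ge> b" unfolding g_def using G_b by (intro cInf_greatest) auto
  define A where "A = 1 + (\<Sum>w\<in>W. \<Sum>l\<in>L. \<bar>\<alpha> w l\<bar>)"
  have A1: "A \<ge> 1" by (simp add: A_def sum_nonneg)
  have A: "\<bar>\<alpha> w l\<bar> \<le> A" if "w \<in> W" "l \<in> L" for w l
  proof -
    have "\<bar>\<alpha> w l\<bar> \<le> (\<Sum>l\<in>L. \<bar>\<alpha> w l\<bar>)" using that L by (intro member_le_sum) auto
    also have "\<dots> \<le> (\<Sum>w\<in>W. \<Sum>l\<in>L. \<bar>\<alpha> w l\<bar>)"
      using that W by (intro member_le_sum[of w W "\<lambda>w. \<Sum>l\<in>L. \<bar>\<alpha> w l\<bar>"]) (auto simp: sum_nonneg)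
    finally show ?thesis by (simp add: A_def)
  qed
  define K where "K = 2 * (g + 1 - b)"
  have K: "K > 0" using gb by (simp add: K_def)
  \<comment> \<open>The first bound keeps the exponents of a step in the range of the quadratic estimate, the second
    makes the quadratic term at most half of \<open>t \<epsilon>\<close>; \<open>\<eta>\<close> takes the other half.\<close>
  define t where "t = min (1 / A) (\<epsilon> / (2 * (K * A\<^sup>2)))"
  have t: "t > 0" "t * A \<le> 1" "K * A\<^sup>2 * t \<le> \<epsilon> / 2"
  proof -
    have KA: "K * A\<^sup>2 > 0" using K A1 by simp
    show "t > 0" unfolding t_def using A1 \<epsilon> KA by simp
    have "t \<le> 1 / A" "t \<le> \<epsilon> / (2 * (K * A\<^sup>2))" by (simp_all add: t_def)
    then show "t * A \<le> 1" "K * A\<^sup>2 * t \<le> \<epsilon> / 2" using A1 KA by (simp_all add: field_simps)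
  qed
  define \<eta> where "\<eta> = min 1 (t * \<epsilon> / 2)"
  have \<eta>: "\<eta> > 0" "\<eta> \<le> 1" "\<eta> \<le> t * \<epsilon> / 2" using t \<epsilon> by (auto simp: \<eta>_def)
  have "\<exists>z\<in>range G. z < g + \<eta>"
    unfolding g_def[symmetric] using cInf_lessD[of "range G" "g + \<eta>"] \<eta>(1) g_def by auto
  then obtain y where y: "G y < g + \<eta>" by auto
  have expK: "(\<Sum>w\<in>W. exp (T y w)) \<le> K" using G_ge[of y] y \<eta>(2) by (simp add: K_def)
  show ?thesis
  proof (rule that[of y])
    fix l assume l: "l \<in> L"
    define D where "D = (\<Sum>w\<in>W. (exp (T y w) - c w) * \<alpha> w l)"
    have step: "- s * D < t * \<epsilon>" if s: "\<bar>s\<bar> = t" for s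
    proof -
      define y' where "y' = y(l := y l + s)"
      have T': "T y' w = T y w + s * \<alpha> w l" for w
      proof -
        have "T y' w = (\<Sum>i\<in>L. y i * \<alpha> w i + (if i = l then s * \<alpha> w l else 0))"
          unfolding T_def y'_def by (intro sum.cong) (auto simp: algebra_simps)
        then show ?thesis using l L by (simp add: sum.distrib T_def)
      qed
      have "G y' \<le> (\<Sum>w\<in>W. exp (T y w) - c w * T y w + s * ((exp (T y w) - c w) * \<alpha> w l)
          + exp (T y w) * (t\<^sup>2 * A\<^sup>2))"
        unfolding G_def
      proof (rule sum_mono)
        fix w assume w: "w \<in> W"
        define d where "d = s * \<alpha> w l"
        have ad: "\<bar>d\<bar> \<le> t * A"
          unfolding d_def abs_mult s using A[OF w l] t(1) by (intro mult_left_mono) auto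
        then have "exp d \<le> 1 + d + d\<^sup>2" using t(2) by (intro exp_quadratic_upper_bound) simp
        moreover have "d\<^sup>2 \<le> (t * A)\<^sup>2"
          using power_mono[OF ad, of 2] by simp
        ultimately have "exp d \<le> 1 + d + t\<^sup>2 * A\<^sup>2" by (simp add: power_mult_distrib)
        then have "exp (T y w) * exp d \<le> exp (T y w) * (1 + d + t\<^sup>2 * A\<^sup>2)"
          by (intro mult_left_mono) auto
        then show "exp (T y' w) - c w * T y' w \<le> exp (T y w) - c w * T y w
            + s * ((exp (T y w) - c w) * \<alpha> w l) + exp (T y w) * (t\<^sup>2 * A\<^sup>2)"
          unfolding T' d_def by (simp add: exp_add algebra_simps)
      qed
      also have "\<dots> = G y + s * D + (\<Sum>w\<in>W. exp (T y w)) * (t\<^sup>2 * A\<^sup>2)"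
        unfolding G_def D_def by (simp only: sum.distrib sum_distrib_left sum_distrib_right)
      also have "\<dots> \<le> G y + s * D + K * (t\<^sup>2 * A\<^sup>2)"
        using expK by (intro add_left_mono mult_right_mono) auto
      finally have "g \<le> G y + s * D + K * (t\<^sup>2 * A\<^sup>2)" using g_le[of y'] by linarith
      moreover have "K * (t\<^sup>2 * A\<^sup>2) \<le> t * \<epsilon> / 2"
        using mult_left_mono[OF t(3), of t] t(1) by (simp add: power2_eq_square algebra_simps)
      ultimately show ?thesis using y \<eta>(3) by simp
    qed
    have "t * D < t * \<epsilon>" using step[of "- t"] t(1) by simp
    moreover have "t * (- D) < t * \<epsilon>" using step[of t] t(1) by simp
    ultimately have "D < \<epsilon>" "- D < \<epsilon>"
      by (simp_all only: mult_less_cancel_left_pos[OF t(1)])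
    then have "\<bar>D\<bar> < \<epsilon>" by (simp add: abs_less_iff)
    then show "\<bar>(\<Sum>w\<in>W. (exp (\<Sum>l\<in>L. y l * \<alpha> w l) - c w) * \<alpha> w l)\<bar> < \<epsilon>"
      by (simp add: D_def T_def)
  qed
qed

section \<open>The function f and the weights of diagonal derivations\<close>

text \<open>
  In terms of \<open>r = n + 2 - t\<close> the function is a constant minus \<open>(r + 2 n / r) / 2\<close>, so
  differences factor.
\<close>

lemma Q_ratio_diff:
  assumes "s < real n + 2" "t < real n + 2"
  shows "Q_ratio n s - Q_ratio n t
    = (s - t) / 2 * (1 - 2 * real n / ((real n + 2 - s) * (real n + 2 - t)))"
  using assms unfolding Q_ratio_def by (simp add: divide_simps) (simp add: algebra_simps)

text \<open>
  The function \<open>r + 2 n / r\<close> of \<open>r = n + 2 - t\<close> decreases up to \<open>r = sqrt (2 n)\<close> and increases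
  afterwards. The integers \<open>p\<close> and \<open>p + 1\<close> enclose the corresponding \<open>t\<close>, so one of them is the
  best integer. The bounds on \<open>p\<close> come from \<open>2 < sqrt (2 n) \<le> n / 2 + 1\<close>.
\<close>

lemma Q_ratio_le_max:
  assumes p: "p = nat \<lfloor>real n + 2 - sqrt (2 * real n)\<rfloor>" and n: "n \<ge> 6"
    and l: "l \<in> {p, p + 1}"
    and max: "Q_ratio n (real l) = max (Q_ratio n (real p)) (Q_ratio n (real (p + 1)))"
  shows "\<And>k. k \<le> n \<Longrightarrow> Q_ratio n (real k) \<le> Q_ratio n (real l)"
    and "n < 2 * p" and "p + 1 \<le> n"
proof -
  define q where "q = sqrt (2 * real n)"
  have q2: "q * q = 2 * real n" by (simp add: q_def)
  have q_gt: "q > 2" unfolding q_def using n by (intro real_less_rsqrt) auto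
  have q_le: "q \<le> real n / 2 + 1"
  proof -
    have "0 \<le> (real n / 2 - 1)\<^sup>2" by simp
    then have "2 * real n \<le> (real n / 2 + 1)\<^sup>2" by (simp add: power2_eq_square field_simps)
    then show ?thesis unfolding q_def by (intro real_le_lsqrt) auto
  qed
  have p1: "real p \<le> real n + 2 - q" and p2: "real n + 2 - q < real p + 1"
    using p q_le unfolding q_def[symmetric] by linarith+
  show "n < 2 * p" using p1 p2 q_le by linarith
  show pn: "p + 1 \<le> n" using p1 q_gt by linarith
  show "Q_ratio n (real k) \<le> Q_ratio n (real l)" if k: "k \<le> n" for k
  proof (cases "k \<le> p")
    case True
    have "q * q \<le> (real n + 2 - real k) * (real n + 2 - real p)"
      using p1 True q_gt by (intro mult_mono) auto
    moreover have "(real n + 2 - real k) * (real n + 2 - real p) > 0"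
      using k pn by (intro mult_pos_pos) auto
    ultimately have "2 * real n / ((real n + 2 - real k) * (real n + 2 - real p)) \<le> 1"
      unfolding q2 by (simp add: divide_le_eq_1_pos)
    then have "(real k - real p) / 2 * (1 - 2 * real n / ((real n + 2 - real k) * (real n + 2 - real p))) \<le> 0"
      using True by (intro mult_nonpos_nonneg) auto
    then have "Q_ratio n (real k) \<le> Q_ratio n (real p)"
      using Q_ratio_diff[of "real k" n "real p"] k pn by simp
    then show ?thesis using max by simp
  next
    case False
    have pos: "(real n + 2 - real k) * (real n + 2 - real (p + 1)) > 0"
      using k pn by (intro mult_pos_pos) auto
    have "(real n + 2 - real k) * (real n + 2 - real (p + 1)) \<le> q * q"
      using p2 False q_gt k pn by (intro mult_mono) auto
    then have "1 \<le> 2 * real n / ((real n + 2 - real k) * (real n + 2 - real (p + 1)))"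
      unfolding q2 using pos by (simp add: le_divide_eq_1_pos)
    then have "(real k - real (p + 1)) / 2
        * (1 - 2 * real n / ((real n + 2 - real k) * (real n + 2 - real (p + 1)))) \<le> 0"
      using False by (intro mult_nonneg_nonpos) auto
    then have "Q_ratio n (real k) \<le> Q_ratio n (real (p + 1))"
      using Q_ratio_diff[of "real k" n "real (p + 1)"] k pn by simp
    then show ?thesis using max by simp
  qed
qed

text \<open>
  For \<open>r\<close> between \<open>2\<close> and \<open>n\<close> the value \<open>r + 2 n / r\<close> is at most \<open>n + 2\<close>, which is its value at
  both ends.
\<close>

lemma Q_ratio_ge_last:
  assumes "2 \<le> k" "k \<le> n" "n \<ge> 6"
  shows "Q_ratio n (real n) \<le> Q_ratio n (real k)"
proof -
  have "2 * real n - 2 * (real n + 2 - real k) \<ge> 0" using assms by simp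
  then have "1 \<le> 2 * real n / ((real n + 2 - real k) * (real n + 2 - real n))"
    using assms by (simp add: le_divide_eq_1_pos)
  then have "(real k - real n) / 2
      * (1 - 2 * real n / ((real n + 2 - real k) * (real n + 2 - real n))) \<ge> 0"
    using assms by (intro mult_nonpos_nonpos) auto
  then show ?thesis using Q_ratio_diff[of "real k" n "real n"] assms by simp
qed

text \<open>
  The eigenvalues of the diagonal derivation of \<open>Q_n\<close> with value \<open>a\<close> on \<open>X_1\<close> and \<open>b\<close> on \<open>X_2\<close>.
\<close>

definition Q_weight :: "nat \<Rightarrow> real \<Rightarrow> real \<Rightarrow> nat \<Rightarrow> real" where
  "Q_weight n a b i =
     (if i = 1 then a else if i = n then 2 * b + (real n - 3) * a else b + (real i - 2) * a)"

lemma sum_Q_weight: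
  assumes "2 \<le> k" "k \<le> n" "n \<ge> 2"
  shows "(\<Sum>i\<in>{k..n}. Q_weight n a b i) = (real n - real k + 2) * (b + Q_ratio n (real k) * a)"
proof -
  have twice: "2 * (\<Sum>i\<in>{k..n}. Q_weight n a b i)
      = 2 * (real n - real k + 2) * b + ((real n - 3) * real n - (real k - 3) * (real k - 2)) * a"
    using assms(2,1)
  proof (induction k rule: inc_induct)
    case base
    then show ?case by (simp add: Q_weight_def algebra_simps)
  next
    case (step k)
    have "(\<Sum>i\<in>{k..n}. Q_weight n a b i) = Q_weight n a b k + (\<Sum>i\<in>{Suc k..n}. Q_weight n a b i)"
      using step.hyps by (simp add: sum.atLeast_Suc_atMost)
    moreover have "Q_weight n a b k = b + (real k - 2) * a"
      using step by (simp add: Q_weight_def)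
    ultimately show ?case using step by (simp add: algebra_simps)
  qed
  have distr: "2 * (r * (b + c / (2 * r) * a)) = 2 * r * b + c * a" if "r > 0" for r c :: real
    using that by (simp add: field_simps)
  have "real n - real k + 2 > 0" using assms by linarith
  from trans[OF twice distr[OF this, symmetric]] show ?thesis
    unfolding Q_ratio_def by simp
qed

text \<open>
  The tail sums are positive multiples of \<open>b + f(k) a\<close>. For \<open>a \<ge> 0\<close> the smallest of these numbers is
  at \<open>k = n\<close>, for \<open>a < 0\<close> it is at \<open>k = l\<close>. The second conclusion is the delicate one for \<open>a < 0\<close>: the
  tail from \<open>3\<close> must exceed \<open>- a\<close>. It does since \<open>b + f(4) a > 0\<close> and
  \<open>(n - 1) (f(4) - f(3)) \<ge> 1\<close>, which for \<open>n > 2\<close> amounts to \<open>(n - 1) (n - 6) \<ge> 0\<close>.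
\<close>

lemma Q_weight_positivity:
  fixes a b :: real
  assumes n: "n \<ge> 6"
    and max: "\<And>k. k \<le> n \<Longrightarrow> Q_ratio n (real k) \<le> Q_ratio n (real l)"
    and l: "2 \<le> l" "l \<le> n"
    and pos: "(\<Sum>i\<in>{n..n}. Q_weight n a b i) > 0" "(\<Sum>i\<in>{l..n}. Q_weight n a b i) > 0"
  shows "\<And>k. 2 \<le> k \<Longrightarrow> k \<le> n \<Longrightarrow> (\<Sum>i\<in>{k..n}. Q_weight n a b i) > 0"
    and "(\<Sum>i\<in>{3..n}. Q_weight n a b i) + a > 0"
    and "(\<Sum>i\<in>{1..n}. Q_weight n a b i) > 0"
proof -
  have bn: "b + Q_ratio n (real n) * a > 0"
    using pos(1) sum_Q_weight[of n n a b] n by simp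
  have bl: "b + Q_ratio n (real l) * a > 0"
    using pos(2) sum_Q_weight[of l n a b] n l by (simp add: zero_less_mult_iff)
  have bk: "b + Q_ratio n (real k) * a > 0" if "2 \<le> k" "k \<le> n" for k
  proof (cases "a \<ge> 0")
    case True
    have "Q_ratio n (real n) * a \<le> Q_ratio n (real k) * a"
      using Q_ratio_ge_last[OF that n] True by (rule mult_right_mono)
    then show ?thesis using bn by linarith
  next
    case False
    have "Q_ratio n (real l) * a \<le> Q_ratio n (real k) * a"
      using max[OF that(2)] False by (intro mult_right_mono_neg) auto
    then show ?thesis using bl by linarith
  qed
  show S: "(\<Sum>i\<in>{k..n}. Q_weight n a b i) > 0" if "2 \<le> k" "k \<le> n" for k
    unfolding sum_Q_weight[OF that order_trans[OF that]]
    using bk[OF that] that by (intro mult_pos_pos) auto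
  show S3: "(\<Sum>i\<in>{3..n}. Q_weight n a b i) + a > 0"
  proof (cases "a \<ge> 0")
    case True
    then show ?thesis using S[of 3] n by simp
  next
    case False
    have "real n + 2 - 4 = real n - 2" "real n + 2 - 3 = real n - 1" "(4 - 3) / 2 = (1 / 2 :: real)"
      by simp_all
    then have "Q_ratio n 4 - Q_ratio n 3 = 1 / 2 * (1 - 2 * real n / ((real n - 2) * (real n - 1)))"
      using Q_ratio_diff[of 4 n 3] n by simp
    then have "(real n - 1) * (Q_ratio n 4 - Q_ratio n 3)
        = (real n - 1) / 2 * (1 - 2 * real n / ((real n - 2) * (real n - 1)))"
      by simp
    also have "\<dots> = (real n * real n - 5 * real n + 2) / (2 * (real n - 2))"
      using n by (simp add: divide_simps) (simp add: algebra_simps)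
    also have "\<dots> \<ge> 1"
    proof -
      have "(real n - 1) * (real n - 6) \<ge> 0" using n by (intro mult_nonneg_nonneg) auto
      then show ?thesis using n by (simp add: field_simps)
    qed
    finally have "((real n - 1) * (Q_ratio n 4 - Q_ratio n 3)) * (- a) \<ge> 1 * (- a)"
      using False by (intro mult_right_mono) auto
    moreover have "(real n - 1) * (b + Q_ratio n 4 * a) > 0"
      using bk[of 4] n by (intro mult_pos_pos) auto
    moreover have "(\<Sum>i\<in>{3..n}. Q_weight n a b i) = (real n - 1) * (b + Q_ratio n 3 * a)"
      using sum_Q_weight[of 3 n a b] n by simp
    ultimately show ?thesis by (simp add: algebra_simps)
  qed
  show "(\<Sum>i\<in>{1..n}. Q_weight n a b i) > 0"
  proof -
    have e: "(\<Sum>i\<in>{1..n}. Q_weight n a b i) = a + (\<Sum>i\<in>{2..n}. Q_weight n a b i)"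
      using n by (subst sum.atLeast_Suc_atMost) (auto simp: Q_weight_def numeral_2_eq_2)
    have e2: "(\<Sum>i\<in>{2..n}. Q_weight n a b i) = b + (\<Sum>i\<in>{3..n}. Q_weight n a b i)"
      using n by (subst sum.atLeast_Suc_atMost) (auto simp: Q_weight_def numeral_3_eq_3 numeral_2_eq_2)
    show ?thesis
    proof (cases "a \<ge> 0")
      case True
      then show ?thesis using e S[of 2] n by simp
    next
      case False
      have "Q_ratio n (real n) = (real n - 3) / 2"
        using n by (simp add: Q_ratio_def field_simps)
      then have "Q_ratio n (real n) * a \<le> 0"
        using n False by (simp add: mult_nonneg_nonpos)
      then have "b > 0" using bn by linarith
      then show ?thesis using e e2 S3 by simp
    qed
  qed
qed

text \<open>
  Give the bracket \<open>[X_1, X_j] = X_(j+1)\<close> the weight \<open>u j\<close> and \<open>[X_j, X_(n+1-j)] = \<plusminus> X_n\<close> the weight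
  \<open>v j\<close>. A weight counts positively at the index of the value of the bracket and negatively at the
  indices of its two arguments; the conclusions say that the resulting vector lies below the weights
  of the derivation in each coordinate. For \<open>3 \<le> k < n\<close> the coordinates from \<open>k\<close> to \<open>n\<close> of that
  vector sum to about \<open>u (k - 1)\<close> when all \<open>v j\<close> except \<open>v 2 = v (n - 1)\<close> are small. So the tail sums \<open>s k\<close> of the derivation weights
  are the natural choice for \<open>u (k - 1)\<close>, and \<open>s n\<close> for \<open>v 2\<close>, both lowered by multiples of a small
  \<open>\<eta>\<close>, while the other \<open>v j\<close> equal \<open>\<eta>\<close>. The multiple of \<open>\<eta>\<close> in \<open>u\<close> decreases with the
  index so that the inequalities between neighbours become strict.
\<close>

lemma Q_weight_dominates:
  fixes a b :: real
  assumes n: "n \<ge> 6"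
    and S: "\<And>k. 2 \<le> k \<Longrightarrow> k \<le> n \<Longrightarrow> (\<Sum>i\<in>{k..n}. Q_weight n a b i) > 0"
    and S3: "(\<Sum>i\<in>{3..n}. Q_weight n a b i) + a > 0"
  obtains u v :: "nat \<Rightarrow> real"
  where "\<And>j. j \<in> {2..n - 2} \<Longrightarrow> u j > 0" and "\<And>j. j \<in> {2..n - 1} \<Longrightarrow> v j > 0"
    and "\<And>j. j \<in> {2..n - 1} \<Longrightarrow> v (n + 1 - j) = v j"
    and "- (\<Sum>j\<in>{2..n - 2}. u j) < Q_weight n a b 1"
    and "- u 2 - v 2 < Q_weight n a b 2"
    and "\<And>i. i \<in> {3..n - 2} \<Longrightarrow> u (i - 1) - u i - v i < Q_weight n a b i"
    and "u (n - 2) - v (n - 1) < Q_weight n a b (n - 1)"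
    and "(\<Sum>j\<in>{2..n - 1}. v j) / 2 < Q_weight n a b n"
proof -
  define s where "s k = (\<Sum>i\<in>{k..n}. Q_weight n a b i)" for k
  define R where "R = insert (s 3 + a) (s ` {2..n})"
  define \<mu> where "\<mu> = Min R"
  have R: "finite R" "R \<noteq> {}" "\<And>x. x \<in> R \<Longrightarrow> x > 0" using S S3 by (auto simp: R_def s_def)
  have \<mu>: "\<mu> > 0" unfolding \<mu>_def using R by (subst Min_gr_iff) auto
  have \<mu>_le: "\<mu> \<le> s k" if "k \<in> {2..n}" for k
    unfolding \<mu>_def using R that by (intro Min_le) (auto simp: R_def)
  have \<mu>_le3: "\<mu> \<le> s 3 + a"
    unfolding \<mu>_def using R by (intro Min_le) (auto simp: R_def)
  \<comment> \<open>At most \<open>3 n\<close> multiples of \<open>\<eta>\<close> have to be absorbed by a quantity that is at least \<open>\<mu>\<close>.\<close>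
  define \<eta> where "\<eta> = \<mu> / (4 * real n)"
  have \<eta>: "\<eta> > 0" "4 * (real n * \<eta>) = \<mu>" using \<mu> n by (auto simp: \<eta>_def)
  have \<eta>6: "6 * \<eta> \<le> real n * \<eta>" using n \<eta>(1) by (intro mult_right_mono) auto
  define u where "u j = s (j + 1) - (2 * real n - (real j + 1)) * \<eta>" for j
  define v where "v j = (if j = 2 \<or> j = n - 1 then s n - real n * \<eta> else \<eta>)" for j
  have s_step: "s k = Q_weight n a b k + s (Suc k)" if "k \<le> n" for k
    using that by (simp add: s_def sum.atLeast_Suc_atMost)
  have u_pos: "u j > 0" if "j \<in> {2..n - 2}" for j
  proof -
    have "(2 * real n - (real j + 1)) * \<eta> \<le> 2 * real n * \<eta>" using \<eta>(1) by (intro mult_right_mono) auto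
    moreover have "\<mu> \<le> s (j + 1)" using \<mu>_le[of "j + 1"] that n by auto
    ultimately show ?thesis using \<eta> \<mu> unfolding u_def by linarith
  qed
  have v_pos: "v j > 0" for j
  proof -
    have "\<mu> \<le> s n" using \<mu>_le n by simp
    then show ?thesis using \<eta> \<mu> unfolding v_def by auto
  qed
  show ?thesis
  proof (rule that[of u v])
    show "u j > 0" if "j \<in> {2..n - 2}" for j by (rule u_pos[OF that])
    show "v j > 0" for j by (rule v_pos)
    show "v (n + 1 - j) = v j" if "j \<in> {2..n - 1}" for j
      using that n by (auto simp: v_def)
    show "- (\<Sum>j\<in>{2..n - 2}. u j) < Q_weight n a b 1"
    proof -
      have "u 2 \<le> (\<Sum>j\<in>{2..n - 2}. u j)"
        using n u_pos by (intro member_le_sum) (auto simp: less_imp_le)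
      moreover have "u 2 > - a"
        using \<mu>_le3 \<eta> \<eta>6 \<mu> by (simp add: u_def algebra_simps numeral_3_eq_3)
      ultimately show ?thesis by (simp add: Q_weight_def)
    qed
    show "- u 2 - v 2 < Q_weight n a b 2"
    proof -
      have "s 2 = Q_weight n a b 2 + s 3" using s_step[of 2] n by (simp add: numeral_3_eq_3 numeral_2_eq_2)
      moreover have "\<mu> \<le> s 2" "\<mu> \<le> s n" using \<mu>_le n by auto
      ultimately show ?thesis using \<eta> \<mu> by (simp add: u_def v_def algebra_simps numeral_3_eq_3)
    qed
    show "u (i - 1) - u i - v i < Q_weight n a b i" if "i \<in> {3..n - 2}" for i
    proof -
      have "v i = \<eta>" using that by (auto simp: v_def)
      moreover have "real (i - 1) = real i - 1" using that by auto
      moreover have "s i = Q_weight n a b i + s (Suc i)" using s_step that by auto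
      ultimately show ?thesis using that \<eta>(1) by (simp add: u_def algebra_simps)
    qed
    show "u (n - 2) - v (n - 1) < Q_weight n a b (n - 1)"
    proof -
      have "real (n - 2) = real n - 2" "Suc (n - 2) = n - 1" using n by auto
      then show ?thesis using s_step[of "n - 1"] n \<eta>(1) by (simp add: u_def v_def algebra_simps)
    qed
    show "(\<Sum>j\<in>{2..n - 1}. v j) / 2 < Q_weight n a b n"
    proof -
      have "{2..n - 1} = insert 2 (insert (n - 1) {3..n - 2})" using n by auto
      moreover have "(\<Sum>j\<in>{3..n - 2}. v j) = (\<Sum>j\<in>{3..n - 2}. \<eta>)"
        using n by (intro sum.cong) (auto simp: v_def)
      moreover have "2 \<notin> insert (n - 1) {3..n - 2}" "n - 1 \<notin> {3..n - 2}" using n by auto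
      moreover have "v 2 = s n - real n * \<eta>" "v (n - 1) = s n - real n * \<eta>" by (simp_all add: v_def)
      ultimately have "(\<Sum>j\<in>{2..n - 1}. v j) = 2 * (s n - real n * \<eta>) + real (n - 4) * \<eta>"
        using n by simp
      moreover have "real (n - 4) * \<eta> \<le> real n * \<eta>" using \<eta>(1) by (intro mult_right_mono) auto
      moreover have "s n = Q_weight n a b n" by (simp add: s_def)
      moreover have "real n * \<eta> > 0" using \<eta>(1) n by simp
      moreover have "(2 * (S - x) + y) / 2 < S" if "y \<le> x" "0 < x" for S x y :: real
        using that by (simp add: field_simps)
      ultimately show ?thesis by metis
    qed
  qed
qed

section \<open>The algebra Q_n and its derivations\<close>

text \<open>
  The structure constants, including the brackets \<open>[X_i, X_1]\<close>. The brackets with value \<open>\<plusminus> X_n\<close> form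
  a family that is already closed under exchanging the arguments.
\<close>

definition Q_coeff :: "nat \<Rightarrow> nat \<Rightarrow> nat \<Rightarrow> nat \<Rightarrow> real" where
  "Q_coeff n i j k =
     (if i = 1 \<and> 2 \<le> j \<and> j \<le> n - 2 then (if k = j + 1 then 1 else 0)
      else if j = 1 \<and> 2 \<le> i \<and> i \<le> n - 2 then (if k = i + 1 then - 1 else 0)
      else if 2 \<le> i \<and> i \<le> n - 1 \<and> i + j = n + 1 then (if k = n then (- 1) ^ (i + 1) else 0)
      else 0)"

lemma sum_eq_single:
  assumes "finite A" "a \<in> A" "\<And>k. k \<in> A \<Longrightarrow> k \<noteq> a \<Longrightarrow> f k = 0"
  shows "sum f A = (f a :: 'b::comm_monoid_add)"
  using assms by (simp add: sum.remove)

lemma Q_bracket: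
  assumes lie: "lie_algebra br" and Q: "is_Q br n X N" and n: "n \<ge> 4"
    and ij: "i \<in> {1..n}" "j \<in> {1..n}"
  shows "br (X i) (X j) = (\<Sum>k\<in>{1..n}. Q_coeff n i j k *\<^sub>R X k)"
proof -
  have Q1: "br (X 1) (X i) = X (i + 1)" if "2 \<le> i" "i \<le> n - 2" for i
    using Q that by (simp add: is_Q_def)
  have Q2: "br (X j) (X (n - j + 1)) = (-1) ^ (j + 1) *\<^sub>R X n" if "2 \<le> j" "j \<le> n - 1" for j
    using Q that by (simp add: is_Q_def)
  consider (a) "i = 1" "2 \<le> j" "j \<le> n - 2" | (b) "j = 1" "2 \<le> i" "i \<le> n - 2"
    | (c) "2 \<le> i" "i \<le> n - 1" "i + j = n + 1"
    | (d) "\<not> (i = 1 \<and> 2 \<le> j \<and> j \<le> n - 2)" "\<not> (j = 1 \<and> 2 \<le> i \<and> i \<le> n - 2)"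
        "\<not> (2 \<le> i \<and> i \<le> n - 1 \<and> i + j = n + 1)"
    by blast
  then show ?thesis
  proof cases
    case a
    have "(\<Sum>k\<in>{1..n}. Q_coeff n i j k *\<^sub>R X k) = Q_coeff n i j (j + 1) *\<^sub>R X (j + 1)"
      using a n by (intro sum_eq_single) (auto simp: Q_coeff_def)
    then show ?thesis using a Q1 by (simp add: Q_coeff_def)
  next
    case b
    have "(\<Sum>k\<in>{1..n}. Q_coeff n i j k *\<^sub>R X k) = Q_coeff n i j (i + 1) *\<^sub>R X (i + 1)"
      using b n by (intro sum_eq_single) (auto simp: Q_coeff_def)
    then show ?thesis using b Q1[of i] lie_skew[OF lie, of "X i" "X 1"] by (simp add: Q_coeff_def)
  next
    case c
    have "(\<Sum>k\<in>{1..n}. Q_coeff n i j k *\<^sub>R X k) = Q_coeff n i j n *\<^sub>R X n"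
      using c n by (intro sum_eq_single) (auto simp: Q_coeff_def)
    moreover have "j = n - i + 1" using c by simp
    moreover have "Q_coeff n i j n = (- 1) ^ (i + 1)" using c by (auto simp: Q_coeff_def)
    ultimately show ?thesis using c(1,2) Q2[of i] by simp
  next
    case d
    have "\<not> Q_listed n i j \<and> \<not> Q_listed n j i" using d n ij by (auto simp: Q_listed_def)
    then have "br (X i) (X j) = 0" using Q ij by (simp add: is_Q_def)
    moreover have "Q_coeff n i j k = 0" for k using d unfolding Q_coeff_def by argo
    ultimately show ?thesis by simp
  qed
qed

text \<open>
  Row \<open>i\<close> of \<open>M\<close> holds the coordinates of the image of \<open>X_i\<close>. Applying the derivation to
  \<open>[X_1, X_j] = X_(j+1)\<close> shifts row \<open>j\<close> to row \<open>j + 1\<close> and adds the diagonal entry of \<open>X_1\<close>, up to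
  multiples of \<open>X_n\<close>; the last row comes from \<open>[X_2, X_(n-1)] = - X_n\<close>. That \<open>X_2\<close> has no
  \<open>X_1\<close>-component in its image follows from \<open>[X_2, X_3] = 0\<close>, whose derivative has this number as its
  coefficient at \<open>X_4\<close>; here \<open>n \<ge> 6\<close> is used, as \<open>X_2\<close> and \<open>X_3\<close> do not commute for \<open>n = 4\<close>.
\<close>

lemma Q_derivation_matrix:
  fixes M :: "nat \<Rightarrow> nat \<Rightarrow> real"
  assumes n: "n \<ge> 6"
    and der: "\<And>i j l. i \<in> {1..n} \<Longrightarrow> j \<in> {1..n} \<Longrightarrow> l \<in> {1..n} \<Longrightarrow>
      (\<Sum>k\<in>{1..n}. Q_coeff n i j k * M k l)
        = (\<Sum>k\<in>{1..n}. M i k * Q_coeff n k j l) + (\<Sum>k\<in>{1..n}. M j k * Q_coeff n i k l)"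
  shows "M 2 1 = 0"
    and "\<And>i l. i \<in> {3..n} \<Longrightarrow> l \<in> {1..<i} \<Longrightarrow> M i l = 0"
    and "\<And>i. i \<in> {2..n - 1} \<Longrightarrow> M i i = M 2 2 + (real i - 2) * M 1 1"
    and "M n n = 2 * M 2 2 + (real n - 3) * M 1 1"
proof -
  \<comment> \<open>The coefficient of \<open>X_l\<close>, \<open>l < n\<close>, in the derivative of \<open>[X_1, X_j] = X_(j+1)\<close>.\<close>
  have rec: "M (j + 1) l = (if 3 \<le> l then M j (l - 1) else 0) + (if l = j + 1 then M 1 1 else 0)"
    if j: "2 \<le> j" "j \<le> n - 2" and l: "1 \<le> l" "l < n" for j l
  proof -
    have "(\<Sum>k\<in>{1..n}. Q_coeff n 1 j k * M k l) = Q_coeff n 1 j (j + 1) * M (j + 1) l"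
      using j n by (intro sum_eq_single) (auto simp: Q_coeff_def)
    moreover have "(\<Sum>k\<in>{1..n}. M 1 k * Q_coeff n k j l) = M 1 1 * Q_coeff n 1 j l"
      using j l n by (intro sum_eq_single) (auto simp: Q_coeff_def)
    moreover have "(\<Sum>k\<in>{1..n}. M j k * Q_coeff n 1 k l) = (if 3 \<le> l then M j (l - 1) else 0)"
    proof (cases "3 \<le> l")
      case True
      have "(\<Sum>k\<in>{1..n}. M j k * Q_coeff n 1 k l) = M j (l - 1) * Q_coeff n 1 (l - 1) l"
        using True l by (intro sum_eq_single) (auto simp: Q_coeff_def)
      moreover have "Q_coeff n 1 (l - 1) l = 1" using True l by (auto simp: Q_coeff_def)
      ultimately show ?thesis using True by simp
    next
      case False
      have "(\<Sum>k\<in>{1..n}. M j k * Q_coeff n 1 k l) = 0"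
        using False l by (intro sum.neutral) (auto simp: Q_coeff_def)
      then show ?thesis using False by simp
    qed
    ultimately show ?thesis using der[of 1 j l] j l by (simp add: Q_coeff_def)
  qed
  have tri: "\<forall>l\<in>{1..<i}. M i l = 0" if "i \<in> {3..n - 1}" for i
  proof -
    have "3 \<le> i" using that by simp
    then have "i \<le> n - 1 \<longrightarrow> (\<forall>l\<in>{1..<i}. M i l = 0)"
    proof (induction i rule: dec_induct)
      case base
      then show ?case using rec[of 2] n by auto
    next
      case (step i)
      show ?case
      proof (intro impI ballI)
        fix l assume i: "Suc i \<le> n - 1" and l: "l \<in> {1..<Suc i}"
        have "\<forall>l\<in>{1..<i}. M i l = 0" using step i by auto
        then have "M i (l - 1) = 0" if "3 \<le> l"
          by (rule bspec) (use that l in auto)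
        then show "M (Suc i) l = 0" using rec[of i l] step(1) i l by auto
      qed
    qed
    then show ?thesis using that by simp
  qed
  show "M 2 1 = 0"
  proof -
    have "(\<Sum>k\<in>{1..n}. Q_coeff n 2 3 k * M k 4) = 0"
      using n by (intro sum.neutral) (auto simp: Q_coeff_def)
    moreover have "(\<Sum>k\<in>{1..n}. M 2 k * Q_coeff n k 3 4) = M 2 1 * Q_coeff n 1 3 4"
      using n by (intro sum_eq_single) (auto simp: Q_coeff_def)
    moreover have "(\<Sum>k\<in>{1..n}. M 3 k * Q_coeff n 2 k 4) = 0"
      using n by (intro sum.neutral) (auto simp: Q_coeff_def)
    moreover have "Q_coeff n 1 3 4 = 1" using n by (auto simp: Q_coeff_def)
    ultimately show ?thesis using der[of 2 3 4] n by simp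
  qed
  have last: "- M n l = (if l = n then - M 2 2 - M (n - 1) (n - 1) else 0)" if l: "l \<in> {1..n}" for l
  proof -
    have "(\<Sum>k\<in>{1..n}. Q_coeff n 2 (n - 1) k * M k l) = Q_coeff n 2 (n - 1) n * M n l"
      using n by (intro sum_eq_single) (auto simp: Q_coeff_def)
    moreover have "(\<Sum>k\<in>{1..n}. M 2 k * Q_coeff n k (n - 1) l) = M 2 2 * Q_coeff n 2 (n - 1) l"
      using n l by (intro sum_eq_single) (auto simp: Q_coeff_def)
    moreover have "(\<Sum>k\<in>{1..n}. M (n - 1) k * Q_coeff n 2 k l)
        = M (n - 1) (n - 1) * Q_coeff n 2 (n - 1) l"
      using n l tri[of "n - 1"] by (intro sum_eq_single) (auto simp: Q_coeff_def)
    ultimately show ?thesis using der[of 2 "n - 1" l] n l by (simp add: Q_coeff_def split: if_splits)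
  qed
  show "M i l = 0" if "i \<in> {3..n}" "l \<in> {1..<i}" for i l
    using that tri[of i] last[of l] by (cases "i = n") auto
  show diag: "M i i = M 2 2 + (real i - 2) * M 1 1" if "i \<in> {2..n - 1}" for i
  proof -
    have "2 \<le> i" using that by simp
    then have "i \<le> n - 1 \<longrightarrow> M i i = M 2 2 + (real i - 2) * M 1 1"
    proof (induction i rule: dec_induct)
      case (step i)
      then show ?case using rec[of i "i + 1"] n by (auto simp: algebra_simps)
    qed simp
    then show ?thesis using that by simp
  qed
  show "M n n = 2 * M 2 2 + (real n - 3) * M 1 1"
  proof -
    have "n - 1 \<in> {2..n - 1}" using n by simp
    from diag[OF this] show ?thesis using last[of n] n by (simp add: of_nat_diff algebra_simps)
  qed
qed

lemma Q_coeff_nonzero_iff: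
  "Q_coeff n i j k \<noteq> 0 \<longleftrightarrow>
    (i = 1 \<and> 2 \<le> j \<and> j \<le> n - 2 \<and> k = j + 1) \<or> (j = 1 \<and> 2 \<le> i \<and> i \<le> n - 2 \<and> k = i + 1) \<or>
    (2 \<le> i \<and> i \<le> n - 1 \<and> i + j = n + 1 \<and> k = n)"
  by (auto simp: Q_coeff_def)

lemma Q_coeff_skew:
  assumes "even n"
  shows "Q_coeff n i j k = - Q_coeff n j i k"
proof (cases "2 \<le> i \<and> i \<le> n - 1 \<and> i + j = n + 1 \<and> k = n")
  case True
  then have "odd (i + j)" using assms by simp
  then have "(- 1 :: real) ^ (i + 1) = - ((- 1) ^ (j + 1))" by (auto simp: uminus_power_if)
  then show ?thesis using True by (auto simp: Q_coeff_def)
next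
  case False
  then show ?thesis by (auto simp: Q_coeff_def)
qed

lemma Q_coeff_square: "(Q_coeff n i j k)\<^sup>2 = (if Q_coeff n i j k \<noteq> 0 then 1 else 0)"
  by (auto simp: Q_coeff_def simp flip: power_mult)

lemma Q_coeff_upper: "Q_coeff n i j k \<noteq> 0 \<Longrightarrow> i < k \<and> j < k"
  unfolding Q_coeff_nonzero_iff by auto

lemma Q_coeff_unique_out: "Q_coeff n i j k \<noteq> 0 \<Longrightarrow> Q_coeff n i j k' \<noteq> 0 \<Longrightarrow> k = k'"
  unfolding Q_coeff_nonzero_iff by auto

lemma Q_coeff_unique_in: "Q_coeff n i j k \<noteq> 0 \<Longrightarrow> Q_coeff n i j' k \<noteq> 0 \<Longrightarrow> j = j'"
  unfolding Q_coeff_nonzero_iff by auto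

lemma Q_adjoint_matrix:
  assumes lie: "lie_algebra br" and ideal: "lie_ideal br N" and Q: "is_Q br n X N" and n: "n \<ge> 6"
  obtains M a b where "\<And>i. i \<in> {1..n} \<Longrightarrow> br y (X i) = (\<Sum>j\<in>{1..n}. M i j *\<^sub>R X j)"
    and "\<And>i j. i \<in> {1..n} \<Longrightarrow> j \<in> {1..<i} \<Longrightarrow> M i j = 0"
    and "\<And>i. i \<in> {1..n} \<Longrightarrow> M i i = Q_weight n a b i"
proof -
  have inj: "inj_on X {1..n}" and ind: "independent (X ` {1..n})" and sp: "span (X ` {1..n}) = N"
    using Q by (auto simp: is_Q_def)
  have bil: "bilinear br" using lie by (simp add: lie_algebra_def)
  have l1: "linear (br x)" and l2: "linear (\<lambda>x. br x z)" for x z using bil by (auto simp: bilinear_def)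
  have "\<exists>a. br y (X i) = (\<Sum>j\<in>{1..n}. a j *\<^sub>R X j)" if i: "i \<in> {1..n}" for i
  proof -
    have "X i \<in> span (X ` {1..n})" using i by (intro span_base imageI)
    then have "br y (X i) \<in> span (X ` {1..n})" unfolding sp using ideal by (simp add: lie_ideal_def)
    then obtain a where "br y (X i) = (\<Sum>j\<in>{1..n}. a j *\<^sub>R X j)"
      by (rule in_span_family[OF finite_atLeastAtMost inj])
    then show ?thesis by blast
  qed
  then have "\<exists>M. \<forall>i\<in>{1..n}. br y (X i) = (\<Sum>j\<in>{1..n}. M i j *\<^sub>R X j)"
    by (intro bchoice ballI)
  then obtain M where M: "\<And>i. i \<in> {1..n} \<Longrightarrow> br y (X i) = (\<Sum>j\<in>{1..n}. M i j *\<^sub>R X j)"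
    by blast
  have der: "(\<Sum>k\<in>{1..n}. Q_coeff n i j k * M k l)
        = (\<Sum>k\<in>{1..n}. M i k * Q_coeff n k j l) + (\<Sum>k\<in>{1..n}. M j k * Q_coeff n i k l)"
    if ij: "i \<in> {1..n}" "j \<in> {1..n}" and l: "l \<in> {1..n}" for i j l
  proof -
    have qb: "br (X i) (X j) = (\<Sum>k\<in>{1..n}. Q_coeff n i j k *\<^sub>R X k)"
      if "i \<in> {1..n}" "j \<in> {1..n}" for i j
      using Q_bracket[OF lie Q _ that] n by simp
    have "br y (br (X i) (X j)) = (\<Sum>l\<in>{1..n}. (\<Sum>k\<in>{1..n}. Q_coeff n i j k * M k l) *\<^sub>R X l)"
    proof -
      have "br y (br (X i) (X j)) = (\<Sum>k\<in>{1..n}. \<Sum>l\<in>{1..n}. (Q_coeff n i j k * M k l) *\<^sub>R X l)"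
        unfolding qb[OF ij] by (simp add: linear_sum[OF l1] linear_scale[OF l1] M scaleR_sum_right)
      then show ?thesis by (subst (asm) sum.swap) (simp add: scaleR_sum_left)
    qed
    moreover have "br (br y (X i)) (X j) = (\<Sum>l\<in>{1..n}. (\<Sum>k\<in>{1..n}. M i k * Q_coeff n k j l) *\<^sub>R X l)"
    proof -
      have "br (br y (X i)) (X j) = (\<Sum>k\<in>{1..n}. \<Sum>l\<in>{1..n}. (M i k * Q_coeff n k j l) *\<^sub>R X l)"
        unfolding M[OF ij(1)] using ij
        by (simp add: linear_sum[OF l2] linear_scale[OF l2] qb scaleR_sum_right)
      then show ?thesis by (subst (asm) sum.swap) (simp add: scaleR_sum_left)
    qed
    moreover have "br (X i) (br y (X j)) = (\<Sum>l\<in>{1..n}. (\<Sum>k\<in>{1..n}. M j k * Q_coeff n i k l) *\<^sub>R X l)"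
    proof -
      have "br (X i) (br y (X j)) = (\<Sum>k\<in>{1..n}. \<Sum>l\<in>{1..n}. (M j k * Q_coeff n i k l) *\<^sub>R X l)"
        unfolding M[OF ij(2)] using ij
        by (simp add: linear_sum[OF l1] linear_scale[OF l1] qb scaleR_sum_right)
      then show ?thesis by (subst (asm) sum.swap) (simp add: scaleR_sum_left)
    qed
    ultimately have "(\<Sum>l\<in>{1..n}. (\<Sum>k\<in>{1..n}. Q_coeff n i j k * M k l) *\<^sub>R X l)
        = (\<Sum>l\<in>{1..n}. ((\<Sum>k\<in>{1..n}. M i k * Q_coeff n k j l)
            + (\<Sum>k\<in>{1..n}. M j k * Q_coeff n i k l)) *\<^sub>R X l)"
      using lie_derivation[OF lie, of y "X i" "X j"] by (simp only: scaleR_left_distrib sum.distrib)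
    from coefficients_unique[OF _ inj ind l this] show ?thesis by simp
  qed
  note mat = Q_derivation_matrix[of n M, OF n der]
  show ?thesis
  proof (rule that[OF M])
    show "M i j = 0" if "i \<in> {1..n}" "j \<in> {1..<i}" for i j
    proof (cases "3 \<le> i")
      case True
      then show ?thesis using mat(2)[of i j] that by simp
    next
      case False
      then have "i = 2" "j = 1" using that by auto
      then show ?thesis using mat(1) by simp
    qed
    show "M i i = Q_weight n (M 1 1) (M 2 2) i" if i: "i \<in> {1..n}" for i
    proof -
      consider "i = 1" | "i \<in> {2..n - 1}" | "i = n" using i by fastforce
      then show ?thesis
      proof cases
        case 2
        then show ?thesis using mat(3)[of i] by (auto simp: Q_weight_def)
      next
        case 3
        then show ?thesis using mat(4) n by (simp add: Q_weight_def)
      qed (simp add: Q_weight_def)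
    qed
  qed
qed

lemma Q_subfamily:
  assumes "is_Q br n X N" "k \<ge> 1"
  shows "inj_on X {k..n}" and "independent (X ` {k..n})"
proof -
  have sub: "{k..n} \<subseteq> {1..n}" using assms(2) by auto
  show "inj_on X {k..n}" using assms(1) inj_on_subset[OF _ sub] by (auto simp: is_Q_def)
  show "independent (X ` {k..n})"
    using assms(1) independent_mono[OF _ image_mono[OF sub]] by (auto simp: is_Q_def)
qed

lemma upper_matrix_tail:
  assumes M: "\<And>i. i \<in> {1..n} \<Longrightarrow> f (X i) = (\<Sum>j\<in>{1..n}. M i j *\<^sub>R X j :: 'a::real_vector)"
    and upper: "\<And>i j. i \<in> {1..n} \<Longrightarrow> j \<in> {1..<i} \<Longrightarrow> M i j = 0"
    and i: "i \<in> {k..n}" and k: "k \<ge> (1::nat)"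
  shows "f (X i) = (\<Sum>j\<in>{k..n}. M i j *\<^sub>R X j)"
proof -
  have "(\<Sum>j\<in>{1..n}. M i j *\<^sub>R X j) = (\<Sum>j\<in>{k..n}. M i j *\<^sub>R X j)"
    using upper i k by (intro sum.mono_neutral_right) auto
  then show ?thesis using M i k by simp
qed

lemma Q_tail_ideal:
  assumes lie: "lie_algebra br" and ideal: "lie_ideal br N" and Q: "is_Q br n X N" and n: "n \<ge> 6"
    and k: "k \<ge> 1"
  shows "lie_ideal br (span (X ` {k..n}))"
  unfolding lie_ideal_def
proof (intro conjI allI ballI)
  show "subspace (span (X ` {k..n}))" by (rule subspace_span)
  fix y v assume v: "v \<in> span (X ` {k..n})"
  have l1: "linear (br y)" using lie by (auto simp: lie_algebra_def bilinear_def)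
  obtain M a b where M: "\<And>i. i \<in> {1..n} \<Longrightarrow> br y (X i) = (\<Sum>j\<in>{1..n}. M i j *\<^sub>R X j)"
    and upper: "\<And>i j. i \<in> {1..n} \<Longrightarrow> j \<in> {1..<i} \<Longrightarrow> M i j = 0"
    using Q_adjoint_matrix[OF lie ideal Q n, of y] by metis
  have in_span: "br y (X i) \<in> span (X ` {k..n})" if "i \<in> {k..n}" for i
  proof -
    have "br y (X i) = (\<Sum>j\<in>{k..n}. M i j *\<^sub>R X j)"
      using M upper by (rule upper_matrix_tail[OF _ _ that k])
    then show ?thesis
      by (simp only:) (rule span_sum, rule span_scale, rule span_base, rule imageI)
  qed
  obtain c where "v = (\<Sum>j\<in>{k..n}. c j *\<^sub>R X j)"
    using in_span_family[OF _ Q_subfamily(1)[OF Q k] v] by auto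
  then have eq: "br y v = (\<Sum>j\<in>{k..n}. c j *\<^sub>R br y (X j))"
    by (simp add: linear_sum[OF l1] linear_scale[OF l1])
  show "br y v \<in> span (X ` {k..n})"
    unfolding eq by (rule span_sum, rule span_scale, rule in_span)
qed

text \<open>
  Within the tail, a bracket with value \<open>\<plusminus> X_n\<close> would need indices with sum \<open>n + 1\<close>, but they add
  up to at least \<open>2 k\<close>.
\<close>

lemma Q_tail_abelian:
  assumes lie: "lie_algebra br" and Q: "is_Q br n X N" and n: "n \<ge> 6"
    and k: "k \<ge> 2" "n + 1 < 2 * k"
    and x: "x \<in> span (X ` {k..n})" and y: "y \<in> span (X ` {k..n})"
  shows "br x y = 0"
proof -
  have k1: "k \<ge> 1" using k by simp
  have l1: "linear (br x)" and l2: "linear (\<lambda>x. br x z)" for x z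
    using lie by (auto simp: lie_algebra_def bilinear_def)
  obtain c where c: "x = (\<Sum>j\<in>{k..n}. c j *\<^sub>R X j)"
    using in_span_family[OF _ Q_subfamily(1)[OF Q k1] x] by auto
  obtain d where d: "y = (\<Sum>j\<in>{k..n}. d j *\<^sub>R X j)"
    using in_span_family[OF _ Q_subfamily(1)[OF Q k1] y] by auto
  have "br (X i) (X j) = 0" if "i \<in> {k..n}" "j \<in> {k..n}" for i j
  proof -
    have "Q_coeff n i j l = 0" for l using that k by (auto simp: Q_coeff_def)
    then show ?thesis using Q_bracket[OF lie Q, of i j] n that k by simp
  qed
  then show ?thesis
    unfolding c d by (simp add: linear_sum[OF l1] linear_scale[OF l1] linear_sum[OF l2] linear_scale[OF l2])
qed

text \<open>
  The trace on the line of \<open>X_n\<close> sees nothing of \<open>N\<close>, as \<open>X_n\<close> is central there. This is how a vector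
  is recognised as lying outside \<open>N\<close>.
\<close>

lemma iota_eq_zero:
  assumes lie: "lie_algebra br" and Q: "is_Q br n X N" and n: "n \<ge> 6" and y: "y \<in> N"
  shows "iota br n X n y = 0"
proof -
  have n1: "n \<ge> 1" using n by simp
  have l1: "linear (br x)" and l2: "linear (\<lambda>x. br x z)" for x z
    using lie by (auto simp: lie_algebra_def bilinear_def)
  obtain c where c: "y = (\<Sum>j\<in>{1..n}. c j *\<^sub>R X j)"
    using in_span_family[of "{1..n}" X y] Q y by (auto simp: is_Q_def)
  have "br (X i) (X n) = 0" if "i \<in> {1..n}" for i
  proof -
    have "Q_coeff n i n l = 0" for l using that n by (auto simp: Q_coeff_def)
    then show ?thesis using Q_bracket[OF lie Q, of i n] n that by simp
  qed
  then have "br y (X n) = 0"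
    unfolding c by (simp add: linear_sum[OF l2] linear_scale[OF l2])
  then have "trace_on (span (X ` {n..n})) (br y) = (\<Sum>i\<in>{n..n}. 0)"
    using Q_subfamily[OF Q n1] l1 by (intro trace_on_family) auto
  then show ?thesis by (simp add: iota_def)
qed

lemma iota_eq_sum:
  assumes lie: "lie_algebra br" and Q: "is_Q br n X N" and k: "k \<ge> 1"
    and M: "\<And>i. i \<in> {1..n} \<Longrightarrow> br y (X i) = (\<Sum>j\<in>{1..n}. M i j *\<^sub>R X j)"
    and upper: "\<And>i j. i \<in> {1..n} \<Longrightarrow> j \<in> {1..<i} \<Longrightarrow> M i j = 0"
    and diag: "\<And>i. i \<in> {1..n} \<Longrightarrow> M i i = d i"
  shows "iota br n X k y = (\<Sum>i\<in>{k..n}. d i)"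
proof -
  have l1: "linear (br y)" using lie by (auto simp: lie_algebra_def bilinear_def)
  have "iota br n X k y = (\<Sum>i\<in>{k..n}. M i i)"
    unfolding iota_def
  proof (rule trace_on_family[OF _ Q_subfamily[OF Q k] l1, where M = M])
    show "br y (X i) = (\<Sum>j\<in>{k..n}. M i j *\<^sub>R X j)" if i: "i \<in> {k..n}" for i
      using M upper by (rule upper_matrix_tail[OF _ _ i k])
  qed simp
  then show ?thesis using diag k by simp
qed

section \<open>Metrics on Q_n with Ricci curvature below a derivation\<close>

text \<open>
  The index set on the left is the disjoint union of three families with one parameter.
\<close>

lemma sum_Q_support:
  fixes f :: "nat \<times> nat \<times> nat \<Rightarrow> real"
  assumes n: "n \<ge> 4"
  shows "(\<Sum>w\<in>{(i, j, k). i \<in> {1..n} \<and> j \<in> {1..n} \<and> k \<in> {1..n} \<and> Q_coeff n i j k \<noteq> 0}. f w)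
    = (\<Sum>j\<in>{2..n - 2}. f (1, j, j + 1) + f (j, 1, j + 1)) + (\<Sum>j\<in>{2..n - 1}. f (j, n + 1 - j, n))"
proof -
  define A where "A = (\<lambda>j. (1::nat, j, j + 1)) ` {2..n - 2}"
  define B where "B = (\<lambda>j. (j, 1::nat, j + 1)) ` {2..n - 2}"
  define C where "C = (\<lambda>j. (j, n + 1 - j, n)) ` {2..n - 1}"
  have "{(i, j, k). i \<in> {1..n} \<and> j \<in> {1..n} \<and> k \<in> {1..n} \<and> Q_coeff n i j k \<noteq> 0} = A \<union> B \<union> C"
  proof (rule subset_antisym; rule subsetI)
    fix w assume "w \<in> {(i, j, k). i \<in> {1..n} \<and> j \<in> {1..n} \<and> k \<in> {1..n} \<and> Q_coeff n i j k \<noteq> 0}"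
    then obtain i j k where w: "w = (i, j, k)" "Q_coeff n i j k \<noteq> 0" by auto
    from w(2) consider (a) "i = 1" "2 \<le> j" "j \<le> n - 2" "k = j + 1"
      | (b) "j = 1" "2 \<le> i" "i \<le> n - 2" "k = i + 1"
      | (c) "2 \<le> i" "i \<le> n - 1" "i + j = n + 1" "k = n"
      unfolding Q_coeff_nonzero_iff by blast
    then show "w \<in> A \<union> B \<union> C"
    proof cases
      case c
      then have "j = n + 1 - i" by simp
      then show ?thesis using c w(1) by (auto simp: C_def)
    qed (auto simp: w(1) A_def B_def)
  next
    fix w assume "w \<in> A \<union> B \<union> C"
    then show "w \<in> {(i, j, k). i \<in> {1..n} \<and> j \<in> {1..n} \<and> k \<in> {1..n} \<and> Q_coeff n i j k \<noteq> 0}"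
      unfolding A_def B_def C_def Q_coeff_nonzero_iff using n by auto
  qed
  moreover have "finite A" "finite B" "finite C" by (simp_all add: A_def B_def C_def)
  moreover have "A \<inter> B = {}" "(A \<union> B) \<inter> C = {}" using n by (auto simp: A_def B_def C_def)
  moreover have "sum f A = (\<Sum>j\<in>{2..n - 2}. f (1, j, j + 1))"
    unfolding A_def by (subst sum.reindex) (auto simp: inj_on_def)
  moreover have "sum f B = (\<Sum>j\<in>{2..n - 2}. f (j, 1, j + 1))"
    unfolding B_def by (subst sum.reindex) (auto simp: inj_on_def)
  moreover have "sum f C = (\<Sum>j\<in>{2..n - 1}. f (j, n + 1 - j, n))"
    unfolding C_def by (subst sum.reindex) (auto simp: inj_on_def)
  ultimately show ?thesis by (simp add: sum.union_disjoint sum.distrib)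
qed

text \<open>
  In the metric for which the vectors \<open>exp (- y i / 2) X_i\<close> are orthonormal, the squared structure
  constants are \<open>exp (y k - y i - y j)\<close>, and the left side is the Ricci curvature in direction \<open>l\<close>.
  It is a quarter of the sum of these exponentials with signs given by \<open>\<alpha>\<close>, over ordered triples.
  The exponentials are chosen to have almost the same signed sums as the weights \<open>2 \<tau> u\<close> and
  \<open>2 \<tau> v\<close>, and the slack in the hypotheses absorbs the error.
\<close>

lemma Q_metric_ricci_below:
  fixes a b \<tau> :: real
  assumes n: "n \<ge> 6" and ev: "even n" and \<tau>: "\<tau> > 0"
    and u: "\<And>j. j \<in> {2..n - 2} \<Longrightarrow> u j > 0" and v: "\<And>j. j \<in> {2..n - 1} \<Longrightarrow> v j > 0"
    and v_sym: "\<And>j. j \<in> {2..n - 1} \<Longrightarrow> v (n + 1 - j) = v j"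
    and w1: "- (\<Sum>j\<in>{2..n - 2}. u j) < d 1"
    and w2: "- u 2 - v 2 < d 2"
    and w3: "\<And>i. i \<in> {3..n - 2} \<Longrightarrow> u (i - 1) - u i - v i < d i"
    and w4: "u (n - 2) - v (n - 1) < d (n - 1)"
    and w5: "(\<Sum>j\<in>{2..n - 1}. v j) / 2 < d n"
  obtains y :: "nat \<Rightarrow> real" where "\<And>l. l \<in> {1..n} \<Longrightarrow>
      - 1/2 * (\<Sum>j\<in>{1..n}. \<Sum>k\<in>{1..n}. (Q_coeff n l j k * exp ((y k - y l - y j) / 2))\<^sup>2)
      + 1/4 * (\<Sum>i\<in>{1..n}. \<Sum>j\<in>{1..n}. (Q_coeff n i j l * exp ((y l - y i - y j) / 2))\<^sup>2)
      < \<tau> * d l"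
proof -
  define W where "W = {(i, j, k). i \<in> {1..n} \<and> j \<in> {1..n} \<and> k \<in> {1..n} \<and> Q_coeff n i j k \<noteq> 0}"
  have W_sub: "W \<subseteq> {1..n} \<times> {1..n} \<times> {1..n}" by (auto simp: W_def)
  then have W: "finite W" by (rule finite_subset) simp
  define \<alpha> :: "nat \<times> nat \<times> nat \<Rightarrow> nat \<Rightarrow> real" where
    "\<alpha> = (\<lambda>(i, j, k) l. (if l = k then 1 else 0) - (if l = i then 1 else 0) - (if l = j then 1 else 0))"
  define c :: "nat \<times> nat \<times> nat \<Rightarrow> real" where
    "c = (\<lambda>(i, j, k). 2 * \<tau> * (if i = 1 then u j else if j = 1 then u i else v i))"
  have c_pos: "c w > 0" if "w \<in> W" for w
    using that u v \<tau> n by (auto simp: W_def c_def Q_coeff_nonzero_iff)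
  define s where "s l = 4 * \<tau> * d l - (\<Sum>w\<in>W. c w * \<alpha> w l)" for l
  have s_pos: "s l > 0" if l: "l \<in> {1..n}" for l
  proof -
    have "(\<Sum>w\<in>W. c w * \<alpha> w l)
      = (\<Sum>j\<in>{2..n - 2}. 4 * \<tau> * ((if l = j + 1 then u j else 0) - (if l = 1 then u j else 0)
            - (if l = j then u j else 0)))
        + (\<Sum>j\<in>{2..n - 1}. 2 * \<tau> * ((if l = n then v j else 0) - (if l = j then v j else 0)
            - (if l = n + 1 - j then v j else 0)))"
      unfolding W_def using n
      by (subst sum_Q_support) (auto simp: c_def \<alpha>_def algebra_simps intro!: arg_cong2[where f = "(+)"] sum.cong)
    also have "\<dots> = 4 * \<tau> * ((\<Sum>j\<in>{2..n - 2}. if l = j + 1 then u j else 0)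
          - (\<Sum>j\<in>{2..n - 2}. if l = 1 then u j else 0) - (\<Sum>j\<in>{2..n - 2}. if l = j then u j else 0))
        + 2 * \<tau> * ((\<Sum>j\<in>{2..n - 1}. if l = n then v j else 0) - (\<Sum>j\<in>{2..n - 1}. if l = j then v j else 0)
          - (\<Sum>j\<in>{2..n - 1}. if l = n + 1 - j then v j else 0))"
      by (simp only: sum_distrib_left[symmetric] sum_subtractf)
    also have "(\<Sum>j\<in>{2..n - 2}. if l = j + 1 then u j else 0) = (if 3 \<le> l \<and> l \<le> n - 1 then u (l - 1) else 0)"
    proof -
      have "(\<Sum>j\<in>{2..n - 2}. if l = j + 1 then u j else 0)
          = (\<Sum>j\<in>{2..n - 2}. if j = l - 1 then u j else 0)"
        using l by (intro sum.cong) auto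
      then show ?thesis using n by (auto split: if_splits)
    qed
    also have "(\<Sum>j\<in>{2..n - 2}. if l = j then u j else 0) = (if 2 \<le> l \<and> l \<le> n - 2 then u l else 0)"
      by simp
    also have "(\<Sum>j\<in>{2..n - 1}. if l = j then v j else 0) = (if 2 \<le> l \<and> l \<le> n - 1 then v l else 0)"
      by simp
    also have "(\<Sum>j\<in>{2..n - 1}. if l = n + 1 - j then v j else 0) = (if 2 \<le> l \<and> l \<le> n - 1 then v l else 0)"
    proof -
      have "(\<Sum>j\<in>{2..n - 1}. if l = n + 1 - j then v j else 0)
          = (\<Sum>j\<in>{2..n - 1}. if j = n + 1 - l then v j else 0)"
        using l by (intro sum.cong) auto
      also have "\<dots> = (if n + 1 - l \<in> {2..n - 1} then v (n + 1 - l) else 0)"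
        by simp
      finally show ?thesis using v_sym l by auto
    qed
    finally have eq: "(\<Sum>w\<in>W. c w * \<alpha> w l)
      = 4 * \<tau> * ((if 3 \<le> l \<and> l \<le> n - 1 then u (l - 1) else 0) - (\<Sum>j\<in>{2..n - 2}. if l = 1 then u j else 0)
            - (if 2 \<le> l \<and> l \<le> n - 2 then u l else 0)
          + (\<Sum>j\<in>{2..n - 1}. if l = n then v j else 0) / 2 - (if 2 \<le> l \<and> l \<le> n - 1 then v l else 0))"
      by (simp add: algebra_simps)
    consider "l = 1" | "l = 2" | "l \<in> {3..n - 2}" | "l = n - 1" | "l = n" using l by fastforce
    then have "(if 3 \<le> l \<and> l \<le> n - 1 then u (l - 1) else 0) - (\<Sum>j\<in>{2..n - 2}. if l = 1 then u j else 0)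
            - (if 2 \<le> l \<and> l \<le> n - 2 then u l else 0)
          + (\<Sum>j\<in>{2..n - 1}. if l = n then v j else 0) / 2 - (if 2 \<le> l \<and> l \<le> n - 1 then v l else 0) < d l"
    proof cases
      case 1
      then show ?thesis using w1 n by simp
    next
      case 2
      moreover have "2 \<le> n - 2" "2 \<le> n - 1" using n by auto
      ultimately show ?thesis using w2 n by simp
    next
      case 3
      then have "3 \<le> l" "l \<le> n - 2" "l \<le> n - 1" "l \<noteq> 1" "l \<noteq> n" using n by auto
      then show ?thesis using w3[of l] by simp
    next
      case 4
      then have "l - 1 = n - 2" using n by simp
      moreover have "3 \<le> l" "\<not> l \<le> n - 2" "l \<noteq> 1" "l \<noteq> n" using n 4 by auto
      ultimately show ?thesis using w4 4 by simp
    next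
      case 5
      then have "\<not> l \<le> n - 1" "\<not> l \<le> n - 2" "l \<noteq> 1" using n by auto
      then show ?thesis using w5 5 by simp
    qed
    then show ?thesis unfolding s_def eq using \<tau> by simp
  qed
  define \<epsilon> where "\<epsilon> = Min (s ` {1..n})"
  have \<epsilon>: "\<epsilon> > 0" unfolding \<epsilon>_def using s_pos n by (subst Min_gr_iff) auto
  have \<epsilon>_le: "\<epsilon> \<le> s l" if "l \<in> {1..n}" for l unfolding \<epsilon>_def using that by simp
  obtain y where y: "\<And>l. l \<in> {1..n} \<Longrightarrow>
      \<bar>(\<Sum>w\<in>W. (exp (\<Sum>l\<in>{1..n}. y l * \<alpha> w l) - c w) * \<alpha> w l)\<bar> < \<epsilon>"
    using approximate_monomial_moments[OF W, of "{1..n}" c \<epsilon> \<alpha>] c_pos \<epsilon> by blast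
  define T where "T i j k = Q_coeff n i j k * exp ((y k - y i - y j) / 2)" for i j k
  have T_sq: "(T i j k)\<^sup>2 = (if Q_coeff n i j k \<noteq> 0 then exp (y k - y i - y j) else 0)" for i j k
    unfolding T_def power_mult_distrib Q_coeff_square by (simp flip: exp_double)
  have T_sym: "(T i j k)\<^sup>2 = (T j i k)\<^sup>2" for i j k
    unfolding T_sq using Q_coeff_skew[OF ev, of i j k] by (auto simp: algebra_simps)
  show ?thesis
  proof (rule that[of y])
    fix l assume l: "l \<in> {1..n}"
    have "(\<Sum>w\<in>W. exp (\<Sum>l\<in>{1..n}. y l * \<alpha> w l) * \<alpha> w l)
        = (\<Sum>(i, j, k)\<in>W. (T i j k)\<^sup>2 * \<alpha> (i, j, k) l)"
    proof (rule sum.cong[OF refl])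
      fix w assume "w \<in> W"
      then obtain i j k where w: "w = (i, j, k)" "i \<in> {1..n}" "j \<in> {1..n}" "k \<in> {1..n}" "Q_coeff n i j k \<noteq> 0"
        by (auto simp: W_def)
      have "(\<Sum>l\<in>{1..n}. y l * \<alpha> w l) = (\<Sum>l\<in>{1..n}. (if l = k then y l else 0)
          - (if l = i then y l else 0) - (if l = j then y l else 0))"
        unfolding w(1) \<alpha>_def by (intro sum.cong) auto
      also have "\<dots> = y k - y i - y j" using w by (simp add: sum_subtractf)
      finally show "exp (\<Sum>l\<in>{1..n}. y l * \<alpha> w l) * \<alpha> w l
          = (case w of (i, j, k) \<Rightarrow> (T i j k)\<^sup>2 * \<alpha> (i, j, k) l)"
        using w by (simp add: T_sq)
    qed
    also have "\<dots> = (\<Sum>(i, j, k)\<in>{1..n} \<times> {1..n} \<times> {1..n}. (T i j k)\<^sup>2 * \<alpha> (i, j, k) l)"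
      using W_sub by (intro sum.mono_neutral_left) (auto simp: W_def T_sq)
    also have "\<dots> = (\<Sum>i\<in>{1..n}. \<Sum>j\<in>{1..n}. \<Sum>k\<in>{1..n}. (T i j k)\<^sup>2 * \<alpha> (i, j, k) l)"
      by (simp add: sum.cartesian_product)
    also have "\<dots> = (\<Sum>i\<in>{1..n}. \<Sum>j\<in>{1..n}. \<Sum>k\<in>{1..n}. if k = l then (T i j k)\<^sup>2 else 0)
        - (\<Sum>i\<in>{1..n}. \<Sum>j\<in>{1..n}. \<Sum>k\<in>{1..n}. if i = l then (T i j k)\<^sup>2 else 0)
        - (\<Sum>i\<in>{1..n}. \<Sum>j\<in>{1..n}. \<Sum>k\<in>{1..n}. if j = l then (T i j k)\<^sup>2 else 0)"
      unfolding sum_subtractf[symmetric] by (intro sum.cong) (auto simp: \<alpha>_def)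
    also have "(\<Sum>i\<in>{1..n}. \<Sum>j\<in>{1..n}. \<Sum>k\<in>{1..n}. if k = l then (T i j k)\<^sup>2 else 0)
        = (\<Sum>i\<in>{1..n}. \<Sum>j\<in>{1..n}. (T i j l)\<^sup>2)"
      using l by simp
    also have "(\<Sum>i\<in>{1..n}. \<Sum>j\<in>{1..n}. \<Sum>k\<in>{1..n}. if i = l then (T i j k)\<^sup>2 else 0)
        = (\<Sum>j\<in>{1..n}. \<Sum>k\<in>{1..n}. (T l j k)\<^sup>2)"
      using l by (subst sum_eq_single[of _ l]) auto
    also have "(\<Sum>i\<in>{1..n}. \<Sum>j\<in>{1..n}. \<Sum>k\<in>{1..n}. if j = l then (T i j k)\<^sup>2 else 0)
        = (\<Sum>i\<in>{1..n}. \<Sum>k\<in>{1..n}. (T l i k)\<^sup>2)"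
    proof (rule sum.cong[OF refl])
      fix i
      show "(\<Sum>j\<in>{1..n}. \<Sum>k\<in>{1..n}. if j = l then (T i j k)\<^sup>2 else 0) = (\<Sum>k\<in>{1..n}. (T l i k)\<^sup>2)"
        using l by (subst sum_eq_single[of _ l]) (auto simp: T_sym[of i])
    qed
    finally have "(\<Sum>w\<in>W. exp (\<Sum>l\<in>{1..n}. y l * \<alpha> w l) * \<alpha> w l)
        = (\<Sum>i\<in>{1..n}. \<Sum>j\<in>{1..n}. (T i j l)\<^sup>2) - 2 * (\<Sum>j\<in>{1..n}. \<Sum>k\<in>{1..n}. (T l j k)\<^sup>2)"
      by simp
    moreover have "(\<Sum>w\<in>W. exp (\<Sum>l\<in>{1..n}. y l * \<alpha> w l) * \<alpha> w l) - (\<Sum>w\<in>W. c w * \<alpha> w l) < \<epsilon>"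
      using y[OF l] by (simp add: left_diff_distrib sum_subtractf abs_less_iff)
    ultimately have "(\<Sum>i\<in>{1..n}. \<Sum>j\<in>{1..n}. (T i j l)\<^sup>2)
        - 2 * (\<Sum>j\<in>{1..n}. \<Sum>k\<in>{1..n}. (T l j k)\<^sup>2) < 4 * (\<tau> * d l)"
      using \<epsilon>_le[OF l] unfolding s_def by simp
    then show "- 1/2 * (\<Sum>j\<in>{1..n}. \<Sum>k\<in>{1..n}. (Q_coeff n l j k * exp ((y k - y l - y j) / 2))\<^sup>2)
      + 1/4 * (\<Sum>i\<in>{1..n}. \<Sum>j\<in>{1..n}. (Q_coeff n i j l * exp ((y l - y i - y j) / 2))\<^sup>2) < \<tau> * d l"
      unfolding T_def by simp
  qed
qed

section \<open>Extensions of Q_n with negative Ricci curvature\<close>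

lemma negative_ricci_iota_pos:
  assumes lie: "lie_algebra br" and ideal: "lie_ideal br N" and Q: "is_Q br n X N" and n: "n \<ge> 6"
    and k: "n + 1 < 2 * k" "k \<le> n"
    and ip: "is_inner_product ip" and neg: "negative_ricci br ip"
  shows "iota br n X k (mean_curvature_vector br ip) > 0"
proof -
  interpret metric_lie_algebra br ip using lie ip by unfold_locales
  have k1: "k \<ge> 1" "k \<ge> 2" using k n by auto
  have "X k \<in> X ` {k..n}" using k by simp
  then have "X k \<noteq> 0" "X k \<in> span (X ` {k..n})"
    using Q_subfamily(2)[OF Q k1(1)] dependent_zero[of "X ` {k..n}"] span_base by metis+
  then have "span (X ` {k..n}) \<noteq> {0}" by auto
  then show ?thesis
    unfolding iota_def
    using abelian_ideal_trace_pos[OF neg Q_tail_ideal[OF lie ideal Q n k1(1)]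
        Q_tail_abelian[OF lie Q n k1(2) k(1)] _ refl] by simp
qed

text \<open>
  The orthonormal basis consists of \<open>Y\<close> and the multiples \<open>exp (- y i / 2) / t^(\<delta> i)\<close> of \<open>X_i\<close>, where
  \<open>\<delta>\<close> is a grading of \<open>Q_n\<close> that increases strictly with the index. The constants inside \<open>N\<close> do not depend on
  \<open>t\<close>, and an entry \<open>M j k\<close> of \<open>ad Y\<close> is multiplied by \<open>t^(\<delta> k - \<delta> j)\<close>. By triangularity only
  the diagonal survives as \<open>t\<close> tends to \<open>0\<close>, and there the Ricci form is negative by the choice of
  \<open>y\<close>; so it is negative definite for some positive \<open>t\<close>.
\<close>

lemma negative_ricci_exists:
  fixes br :: "'a::real_vector \<Rightarrow> 'a \<Rightarrow> 'a"
  assumes lie: "lie_algebra br" and ideal: "lie_ideal br N" and Q: "is_Q br n X N"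
    and n: "n \<ge> 6" and ev: "even n"
    and sum: "is_direct_sum UNIV (span {Y}) N" and Y: "Y \<notin> N"
    and M: "\<And>i. i \<in> {1..n} \<Longrightarrow> br Y (X i) = (\<Sum>j\<in>{1..n}. M i j *\<^sub>R X j)"
    and upper: "\<And>i j. i \<in> {1..n} \<Longrightarrow> j \<in> {1..<i} \<Longrightarrow> M i j = 0"
    and diag: "\<And>i. i \<in> {1..n} \<Longrightarrow> M i i = Q_weight n a b i"
    and S: "\<And>k. 2 \<le> k \<Longrightarrow> k \<le> n \<Longrightarrow> (\<Sum>i\<in>{k..n}. Q_weight n a b i) > 0"
    and S3: "(\<Sum>i\<in>{3..n}. Q_weight n a b i) + a > 0"
    and S1: "(\<Sum>i\<in>{1..n}. Q_weight n a b i) > 0"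
  shows "\<exists>ip. is_inner_product ip \<and> negative_ricci br ip"
proof -
  define d where "d = Q_weight n a b"
  define \<tau> where "\<tau> = (\<Sum>i\<in>{1..n}. d i)"
  have \<tau>: "\<tau> > 0" using S1 by (simp add: \<tau>_def d_def)
  obtain u v where uv: "\<And>j. j \<in> {2..n - 2} \<Longrightarrow> u j > 0" "\<And>j. j \<in> {2..n - 1} \<Longrightarrow> v j > 0"
    "\<And>j. j \<in> {2..n - 1} \<Longrightarrow> v (n + 1 - j) = v j"
    "- (\<Sum>j\<in>{2..n - 2}. u j) < d 1" "- u 2 - v 2 < d 2"
    "\<And>i. i \<in> {3..n - 2} \<Longrightarrow> u (i - 1) - u i - v i < d i"
    "u (n - 2) - v (n - 1) < d (n - 1)" "(\<Sum>j\<in>{2..n - 1}. v j) / 2 < d n"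
    unfolding d_def using Q_weight_dominates[OF n S S3] by blast
  obtain y :: "nat \<Rightarrow> real" where y: "\<And>l. l \<in> {1..n} \<Longrightarrow>
      - 1/2 * (\<Sum>j\<in>{1..n}. \<Sum>k\<in>{1..n}. (Q_coeff n l j k * exp ((y k - y l - y j) / 2))\<^sup>2)
      + 1/4 * (\<Sum>i\<in>{1..n}. \<Sum>j\<in>{1..n}. (Q_coeff n i j l * exp ((y l - y i - y j) / 2))\<^sup>2)
      < \<tau> * d l"
    using Q_metric_ricci_below[OF n ev \<tau> uv] by blast
  define T where "T i j k = Q_coeff n i j k * exp ((y k - y i - y j) / 2)" for i j k
  define f where "f i = (if i = 0 then Y else X i)" for i
  define K where "K i j k = (if k = 0 then 0 else if i = 0 then (if j = 0 then 0 else M j k)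
      else if j = 0 then - M i k else Q_coeff n i j k)" for i j k
  define \<delta> where "\<delta> i = (if i = n then n + 1 else i)" for i
  define r where "r t i = (if i = 0 then 1 else exp (- y i / 2) / t ^ \<delta> i)" for t :: real and i
  define C where "C t i j k = K i j k * (r t i * r t j / r t k)" for t i j k
  have I: "{..n} = insert 0 {1..n}" by auto
  have inj1: "inj_on X {1..n}" and ind1: "independent (X ` {1..n})" and sp1: "span (X ` {1..n}) = N"
    using Q by (auto simp: is_Q_def)
  have f_img: "f ` {..n} = insert Y (X ` {1..n})" unfolding I by (auto simp: f_def)
  have Y': "Y \<notin> X ` {1..n}" using Y sp1 span_base by metis
  have "inj_on f {1..n} \<longleftrightarrow> inj_on X {1..n}" by (rule inj_on_cong) (simp add: f_def)
  moreover have "f ` ({1..n} - {0}) = X ` {1..n}" by (auto simp: f_def)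
  ultimately have inj: "inj_on f {..n}" unfolding I inj_on_insert using inj1 Y' by (simp add: f_def)
  have ind: "independent (f ` {..n})"
    unfolding f_img using Y ind1 unfolding sp1[symmetric] by (rule independent_insertI)
  have sp: "span (f ` {..n}) = UNIV"
  proof -
    have "x \<in> span (insert Y (X ` {1..n}))" for x
    proof -
      have "x \<in> {u + w |u w. u \<in> span {Y} \<and> w \<in> N}" using sum by (auto simp: is_direct_sum_def)
      then obtain u w where x: "x = u + w" "u \<in> span {Y}" "w \<in> span (X ` {1..n})" using sp1 by blast
      have "u \<in> span (insert Y (X ` {1..n}))" using x(2) span_mono[of "{Y}" "insert Y (X ` {1..n})"] by blast
      moreover have "w \<in> span (insert Y (X ` {1..n}))"
        using x(3) span_mono[of "X ` {1..n}" "insert Y (X ` {1..n})"] by blast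
      ultimately show ?thesis unfolding x(1) by (rule span_add)
    qed
    then show ?thesis unfolding f_img by blast
  qed
  have l1: "linear (br x)" and l2: "linear (\<lambda>x. br x z)" for x z
    using lie by (auto simp: lie_algebra_def bilinear_def)
  have brK: "br (f i) (f j) = (\<Sum>k\<in>{..n}. K i j k *\<^sub>R f k)" if ij: "i \<in> {..n}" "j \<in> {..n}" for i j
  proof -
    have R: "(\<Sum>k\<in>{..n}. K i j k *\<^sub>R f k) = (\<Sum>k\<in>{1..n}. K i j k *\<^sub>R X k)"
      unfolding I by (simp add: K_def f_def)
    consider "i = 0" "j = 0" | "i = 0" "j \<in> {1..n}" | "i \<in> {1..n}" "j = 0" | "i \<in> {1..n}" "j \<in> {1..n}"
      using ij by fastforce
    then show ?thesis
    proof cases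
      case 1
      then show ?thesis unfolding R using lie by (simp add: K_def f_def lie_algebra_def)
    next
      case 2
      then show ?thesis unfolding R using M[OF 2(2)] by (simp add: K_def f_def)
    next
      case 3
      then show ?thesis unfolding R using M[OF 3(1)] lie_skew[OF lie, of "X i" Y]
        by (simp add: K_def f_def sum_negf)
    next
      case 4
      then show ?thesis unfolding R using Q_bracket[OF lie Q _ 4] n by (simp add: K_def f_def)
    qed
  qed
  have lim: "((\<lambda>t. C t i j k) \<longlongrightarrow> extension_coeff d T i j k) (at_right 0)"
    if ijk: "i \<in> {..n}" "j \<in> {..n}" "k \<in> {..n}" for i j k
  proof -
    have pos: "\<forall>\<^sub>F t :: real in at_right 0. t > 0" by (rule eventually_at_right_less)
    have lim_M: "((\<lambda>t. M j k * (r t j / r t k)) \<longlongrightarrow> (if k = j then d j else 0)) (at_right 0)"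
      if jk: "j \<in> {1..n}" "k \<in> {1..n}" for j k
    proof -
      consider "k < j" | "k = j" | "k > j" by linarith
      then show ?thesis
      proof cases
        case 1
        then show ?thesis using upper[of j k] jk by simp
      next
        case 2
        have "\<forall>\<^sub>F t in at_right 0. M j k * (r t j / r t k) = d j"
          using pos
        proof (rule eventually_mono)
          fix t :: real assume "t > 0"
          then show "M j k * (r t j / r t k) = d j" using 2 jk diag by (simp add: r_def d_def)
        qed
        then show ?thesis using 2 by (simp add: tendsto_eventually)
      next
        case 3
        then have \<delta>: "\<delta> k > \<delta> j" using jk by (simp add: \<delta>_def)
        have "((\<lambda>t. M j k * (exp (- y j / 2) / exp (- y k / 2)) * t ^ (\<delta> k - \<delta> j))
            \<longlongrightarrow> M j k * (exp (- y j / 2) / exp (- y k / 2)) * 0 ^ (\<delta> k - \<delta> j)) (at_right (0::real))"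
          by (intro tendsto_intros)
        then have "((\<lambda>t. M j k * (exp (- y j / 2) / exp (- y k / 2)) * t ^ (\<delta> k - \<delta> j))
            \<longlongrightarrow> 0) (at_right (0::real))"
          using \<delta> by (simp only: zero_power zero_less_diff mult_zero_right)
        moreover have "\<forall>\<^sub>F t in at_right 0. M j k * (r t j / r t k)
            = M j k * (exp (- y j / 2) / exp (- y k / 2)) * t ^ (\<delta> k - \<delta> j)"
          using pos
        proof (rule eventually_mono)
          fix t :: real assume t: "t > 0"
          have "t ^ \<delta> k = t ^ (\<delta> k - \<delta> j) * t ^ \<delta> j" using \<delta> by (simp flip: power_add)
          then show "M j k * (r t j / r t k)
            = M j k * (exp (- y j / 2) / exp (- y k / 2)) * t ^ (\<delta> k - \<delta> j)"
            using t jk by (simp add: r_def)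
        qed
        ultimately show ?thesis using 3 by (simp add: tendsto_cong)
      qed
    qed
    consider "k = 0" | "k \<noteq> 0" "i = 0" "j = 0" | "k \<noteq> 0" "i = 0" "j \<noteq> 0" | "k \<noteq> 0" "i \<noteq> 0" "j = 0"
      | "k \<noteq> 0" "i \<noteq> 0" "j \<noteq> 0" by blast
    then show ?thesis
    proof cases
      case 1
      then show ?thesis by (simp add: C_def K_def extension_coeff_def)
    next
      case 2
      then show ?thesis by (simp add: C_def K_def extension_coeff_def)
    next
      case 3
      then show ?thesis using lim_M[of j k] ijk by (simp add: C_def K_def extension_coeff_def r_def[of _ 0])
    next
      case 4
      then have "((\<lambda>t. - (M i k * (r t i / r t k))) \<longlongrightarrow> - (if k = i then d i else 0)) (at_right 0)"
        using ijk by (intro tendsto_minus lim_M) auto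
      then show ?thesis using 4
        by (simp add: C_def K_def extension_coeff_def r_def[of _ 0] split: if_splits)
    next
      case 5
      have "\<forall>\<^sub>F t in at_right 0. C t i j k = T i j k"
        using pos
      proof (rule eventually_mono)
        fix t :: real assume t: "t > 0"
        show "C t i j k = T i j k"
        proof (cases "Q_coeff n i j k = 0")
          case False
          then have "\<delta> k = \<delta> i + \<delta> j" using n unfolding Q_coeff_nonzero_iff by (auto simp: \<delta>_def)
          then have "r t i * r t j / r t k = exp (- y i / 2) * exp (- y j / 2) / exp (- y k / 2)"
            using t 5 by (simp add: r_def power_add)
          also have "\<dots> = exp (- y i / 2 + - y j / 2 - - y k / 2)" by (simp only: exp_add exp_diff)
          also have "- y i / 2 + - y j / 2 - - y k / 2 = (y k - y i - y j) / 2" by (simp add: field_simps)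
          finally show ?thesis using 5 by (simp add: C_def K_def T_def)
        qed (use 5 in \<open>simp add: C_def K_def T_def\<close>)
      qed
      then show ?thesis using 5 by (simp add: extension_coeff_def tendsto_eventually)
    qed
  qed
  have T_skew: "T i j k = - T j i k" for i j k
    using Q_coeff_skew[OF ev, of i j k] by (simp add: T_def algebra_simps)
  have T_nz: "T i j k \<noteq> 0 \<longleftrightarrow> Q_coeff n i j k \<noteq> 0" for i j k by (simp add: T_def)
  have ricci0: "ricci_coeff {..n} (extension_coeff d T) i j =
    (if i \<noteq> j then 0 else if i = 0 then - (\<Sum>k\<in>{1..n}. (d k)\<^sup>2)
     else - (\<Sum>k\<in>{1..n}. d k) * d i
       - 1/2 * (\<Sum>k\<in>{1..n}. \<Sum>l\<in>{1..n}. (T i k l)\<^sup>2)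
       + 1/4 * (\<Sum>k\<in>{1..n}. \<Sum>l\<in>{1..n}. (T k l i)\<^sup>2))" if ij: "i \<in> {..n}" "j \<in> {..n}" for i j
  proof (rule ricci_coeff_diagonal_extension[OF T_skew])
    show "i < k \<and> j < k" if "T i j k \<noteq> 0" for i j k
      using that unfolding T_nz by (rule Q_coeff_upper)
    show "k = k'" if "T i j k \<noteq> 0" "T i j k' \<noteq> 0" for i j k k'
      using that unfolding T_nz by (rule Q_coeff_unique_out)
    show "j = j'" if "T i j k \<noteq> 0" "T i j' k \<noteq> 0" for i j j' k
      using that unfolding T_nz by (rule Q_coeff_unique_in)
  qed (use ij in auto)
  have "\<forall>\<^sub>F t in at_right 0. \<forall>x. (\<exists>i\<in>{..n}. x i \<noteq> 0) \<longrightarrow>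
      (\<Sum>i\<in>{..n}. \<Sum>j\<in>{..n}. x i * x j * ricci_coeff {..n} (C t) i j) < 0"
  proof (rule eventually_quadratic_form_neg)
    show "((\<lambda>t. ricci_coeff {..n} (C t) i j) \<longlongrightarrow> ricci_coeff {..n} (extension_coeff d T) i j) (at_right 0)"
      if "i \<in> {..n}" "j \<in> {..n}" for i j
      unfolding ricci_coeff_def using that by (intro tendsto_intros lim) auto
    show "ricci_coeff {..n} (extension_coeff d T) i j = 0" if "i \<in> {..n}" "j \<in> {..n}" "i \<noteq> j" for i j
      using ricci0[OF that(1,2)] that(3) by simp
    show "ricci_coeff {..n} (extension_coeff d T) i i < 0" if i: "i \<in> {..n}" for i
    proof (cases "i = 0")
      case True
      have "d n > 0" using S[of n] n by (simp add: d_def)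
      then have "(\<Sum>k\<in>{1..n}. (d k)\<^sup>2) > 0" using n by (intro sum_pos2[of _ n]) auto
      then show ?thesis using ricci0[OF i i] True by simp
    next
      case False
      then have "i \<in> {1..n}" using i by simp
      from y[OF this] show ?thesis unfolding ricci0[OF i i] using False by (simp add: T_def \<tau>_def)
    qed
  qed simp
  then have "\<forall>\<^sub>F t in at_right (0::real). t > 0 \<and> (\<forall>x. (\<exists>i\<in>{..n}. x i \<noteq> 0) \<longrightarrow>
      (\<Sum>i\<in>{..n}. \<Sum>j\<in>{..n}. x i * x j * ricci_coeff {..n} (C t) i j) < 0)"
    by (rule eventually_conj[OF eventually_at_right_less])
  then obtain t :: real where t: "t > 0"
    and negative: "\<And>x. \<exists>i\<in>{..n}. x i \<noteq> 0 \<Longrightarrow>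
      (\<Sum>i\<in>{..n}. \<Sum>j\<in>{..n}. x i * x j * ricci_coeff {..n} (C t) i j) < 0"
    using eventually_happens' trivial_limit_at_right_real by blast
  have r_nz: "r t i \<noteq> 0" for i using t by (simp add: r_def)
  obtain ip where ip: "is_inner_product ip"
    and on: "\<And>i j. i \<in> {..n} \<Longrightarrow> j \<in> {..n} \<Longrightarrow>
      ip (r t i *\<^sub>R f i) (r t j *\<^sub>R f j) = (if i = j then 1 else 0)"
    by (rule frame_inner_product[of "{..n}" f "r t", OF finite_atMost inj ind sp r_nz]) (rule that)
  interpret metric_lie_algebra br ip using lie ip by unfold_locales
  define e where "e i = r t i *\<^sub>R f i" for i
  have fe: "f i = (1 / r t i) *\<^sub>R e i" for i using r_nz by (simp add: e_def)
  have e_span: "span (e ` {..n}) = UNIV"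
  proof -
    have "f i \<in> span (e ` {..n})" if "i \<in> {..n}" for i
      unfolding fe by (intro span_scale span_base imageI that)
    then have "span (f ` {..n}) \<subseteq> span (e ` {..n})" by (intro span_minimal) auto
    then show ?thesis using sp by auto
  qed
  have brC: "br (e i) (e j) = (\<Sum>k\<in>{..n}. C t i j k *\<^sub>R e k)" if "i \<in> {..n}" "j \<in> {..n}" for i j
  proof -
    have "br (e i) (e j) = (\<Sum>k\<in>{..n}. (r t i * (r t j * K i j k)) *\<^sub>R f k)"
      unfolding e_def using brK[OF that]
      by (simp add: linear_scale[OF l1] linear_scale[OF l2] scaleR_sum_right mult_ac)
    also have "\<dots> = (\<Sum>k\<in>{..n}. C t i j k *\<^sub>R e k)"
      unfolding fe by (intro sum.cong) (auto simp: C_def field_simps)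
    finally show ?thesis .
  qed
  have "negative_ricci br ip"
    unfolding negative_ricci_def
  proof (intro allI impI)
    fix x :: 'a assume "x \<noteq> 0"
    obtain c where c: "x = (\<Sum>i\<in>{..n}. c i *\<^sub>R f i)"
      using in_span_family[OF finite_atMost inj, of x] sp by auto
    define g where "g i = c i / r t i" for i
    have x: "x = (\<Sum>i\<in>{..n}. g i *\<^sub>R e i)" unfolding c g_def e_def using r_nz by simp
    have "\<exists>i\<in>{..n}. g i \<noteq> 0"
    proof (rule ccontr)
      assume "\<not> (\<exists>i\<in>{..n}. g i \<noteq> 0)"
      then have "x = 0" unfolding x by (intro sum.neutral) auto
      then show False using \<open>x \<noteq> 0\<close> by simp
    qed
    then have "(\<Sum>i\<in>{..n}. \<Sum>j\<in>{..n}. g i * g j * ricci_coeff {..n} (C t) i j) < 0" by (rule negative)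
    moreover have "ric br ip x = (\<Sum>i\<in>{..n}. \<Sum>j\<in>{..n}. g i * g j * ricci_coeff {..n} (C t) i j)"
      unfolding x using on e_span brC by (intro ric_structure_constants) (auto simp: e_def)
    ultimately show "ric br ip x < 0" by simp
  qed
  then show ?thesis using ip by blast
qed

theorem theorem4:
  fixes br :: "'a::real_vector \<Rightarrow> 'a \<Rightarrow> 'a"
    and N :: "'a set" and X :: "nat \<Rightarrow> 'a" and m n p l :: nat
  assumes "n = 2 * m" and "m > 2"
    and "lie_algebra br"
    and "\<not> lie_nilpotent br (UNIV :: 'a set)"
    and "one_dim_extension br N"
    and "is_Q br n X N"
    and "p = nat \<lfloor>real n + 2 - sqrt (2 * real n)\<rfloor>"
    and "l \<in> {p, p + 1}"
    and "Q_ratio n (real l) = max (Q_ratio n (real p)) (Q_ratio n (real (p + 1)))"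
  shows "(\<exists>ip. is_inner_product ip \<and> negative_ricci br ip) \<longleftrightarrow>
         (\<exists>Y. is_direct_sum UNIV (span {Y}) N \<and> iota br n X n Y > 0 \<and> iota br n X l Y > 0)"
proof -
  have n: "n \<ge> 6" and ev: "even n" using assms(1,2) by auto
  have lie: "lie_algebra br" and Q: "is_Q br n X N" by fact+
  have ideal: "lie_ideal br N" and dim: "dim (UNIV :: 'a set) = dim N + 1"
    using assms(5) by (auto simp: one_dim_extension_def is_nilradical_def)
  note ratio = Q_ratio_le_max[OF assms(7) n assms(8,9)]
  have p: "n < 2 * p" "p + 1 \<le> n" by (rule ratio(2,3))+
  have l: "n + 1 < 2 * l" "l \<le> n" "2 \<le> l"
    using p assms(1,2,8) by auto
  show ?thesis
  proof
    assume "\<exists>ip. is_inner_product ip \<and> negative_ricci br ip"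
    then obtain ip where ip: "is_inner_product ip" "negative_ricci br ip" by blast
    define H where "H = mean_curvature_vector br ip"
    have pos: "iota br n X n H > 0" "iota br n X l H > 0"
      unfolding H_def using n l by (auto intro!: negative_ricci_iota_pos[OF lie ideal Q n _ _ ip])
    then have "H \<notin> N" using iota_eq_zero[OF lie Q n, of H] by auto
    moreover obtain C :: "'a set" where C: "finite C" "span C = UNIV"
      using lie by (auto simp: lie_algebra_def)
    ultimately have "is_direct_sum UNIV (span {H}) N"
      using Q dim by (intro direct_sum_line[OF C, of "X ` {1..n}"]) (auto simp: is_Q_def)
    then show "\<exists>Y. is_direct_sum UNIV (span {Y}) N \<and> iota br n X n Y > 0 \<and> iota br n X l Y > 0"
      using pos by blast
  next
    assume "\<exists>Y. is_direct_sum UNIV (span {Y}) N \<and> iota br n X n Y > 0 \<and> iota br n X l Y > 0"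
    then obtain Y where Y: "is_direct_sum UNIV (span {Y}) N" "iota br n X n Y > 0" "iota br n X l Y > 0"
      by blast
    have YN: "Y \<notin> N" using iota_eq_zero[OF lie Q n, of Y] Y(2) by auto
    obtain M a b where M: "\<And>i. i \<in> {1..n} \<Longrightarrow> br Y (X i) = (\<Sum>j\<in>{1..n}. M i j *\<^sub>R X j)"
      "\<And>i j. i \<in> {1..n} \<Longrightarrow> j \<in> {1..<i} \<Longrightarrow> M i j = 0"
      "\<And>i. i \<in> {1..n} \<Longrightarrow> M i i = Q_weight n a b i"
      using Q_adjoint_matrix[OF lie ideal Q n, of Y] by blast
    have iota: "iota br n X k Y = (\<Sum>i\<in>{k..n}. Q_weight n a b i)" if "k \<ge> 1" for k
      using M by (rule iota_eq_sum[OF lie Q that])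
    have "(\<Sum>i\<in>{n..n}. Q_weight n a b i) > 0" "(\<Sum>i\<in>{l..n}. Q_weight n a b i) > 0"
      using Y(2,3) iota[of n] iota[of l] n l by auto
    from Q_weight_positivity[OF n ratio(1) l(3,2) this]
    show "\<exists>ip. is_inner_product ip \<and> negative_ricci br ip"
      by (intro negative_ricci_exists[OF lie ideal Q n ev Y(1) YN M]) auto
  qed
qed

end
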